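(* There exists a distribution over sequences of $n$ updates and queries for the Group Range Problem (with group $G$ and binary encoding $e:G\to\{0,1\}^s$) such that the following holds. For any randomized cell-probe data structure $D$ with word size $w=\Theta(\log n)$ which, on an input drawn from this distribution, with probability $p$ both answers at least a $(\frac12+\delta)$-fraction of the queries correctly and spends at most $\epsilon n\log n$ total running time, we must have $p\le \exp(-\delta^2 n)$, as long as $s\le(1+\epsilon)\log|G|$, $\delta^2\gg\epsilon\ge\Omega(1/\log n)$, and $n$ is sufficiently large.
   Context: Group Range Problem: $G$ is a group with an injective binary encoding $e:G\to\{0,1\}^s$. A data structure stores a sequence $a_0,\dots,a_{n-1}\in G$ and supports Update$(i,a)$, which sets $a_i\leftarrow a$, and Query$(\ell,r,i)$, which returns the $i$-th bit of $e(a_\ell a_{\ell+1}\cdots a_r)$. The setting is the cell-probe model: memory consists of cells of $w$ bits, and the running time of an operation is the number of memory cells it probes (reads or writes); all other computation is free. The group is polynomially sized: $\log|G|=O(w)$. Notation: $\exp(f(n))$ means $2^{\Theta(f(n))}$; logarithms are base 2.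
   Formalization: "Polynomially sized" is taken as log|G| = Θ(w), not just log|G| = O(w): for log|G| = o(w) (e.g. |G| = 2) a tree packing many children's products per word answers all queries in o(log n) probes each, so the claim fails. *)

theory Defs
  imports "HOL-Algebra.Group" "HOL-Probability.Probability"
begin

section \<open>The cell-probe model\<close>

text \<open>
  Memory is an unbounded array of cells addressed by natural numbers; a word of \<open>w\<close> bits is
  identified with a natural number below \<open>2 ^ w\<close>.  An operation is an adaptive sequence of
  probes: the continuation of a read is an arbitrary function of the word that was read, so
  computation other than probing is free.  Every path through a program is finite.
\<close>

type_synonym memory = "nat \<Rightarrow> nat"

datatype 'r prog =
    Return 'r
  | Read nat "nat \<Rightarrow> 'r prog"
  | Write nat nat "'r prog"

text \<open>The result, the final memory and the number of probes.\<close>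

primrec exec :: "'r prog \<Rightarrow> memory \<Rightarrow> 'r \<times> memory \<times> nat" where
  "exec (Return x) m = (x, m, 0)"
| "exec (Read c k) m = (let (x, m', t) = exec (k (m c)) m in (x, m', Suc t))"
| "exec (Write c v q) m = (let (x, m', t) = exec q (m(c := v)) in (x, m', Suc t))"

text \<open>All words written have \<open>w\<close> bits, provided that all words read have \<open>w\<close> bits.\<close>

primrec fits :: "nat \<Rightarrow> 'r prog \<Rightarrow> bool" where
  "fits w (Return x) \<longleftrightarrow> True"
| "fits w (Read c k) \<longleftrightarrow> (\<forall>v. v < 2 ^ w \<longrightarrow> fits w (k v))"
| "fits w (Write c v q) \<longleftrightarrow> v < 2 ^ w \<and> fits w q"


section \<open>The Group Range Problem\<close>

datatype 'g operation =
    Update nat 'g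
  | Query nat nat nat

primrec is_query :: "'g operation \<Rightarrow> bool" where
  "is_query (Update i a) \<longleftrightarrow> False"
| "is_query (Query l r i) \<longleftrightarrow> True"

primrec valid_op :: "'g monoid \<Rightarrow> nat \<Rightarrow> nat \<Rightarrow> 'g operation \<Rightarrow> bool" where
  "valid_op G n s (Update i a) \<longleftrightarrow> i < n \<and> a \<in> carrier G"
| "valid_op G n s (Query l r i) \<longleftrightarrow> l \<le> r \<and> r < n \<and> i < s"

definition op_sequences :: "'g monoid \<Rightarrow> nat \<Rightarrow> nat \<Rightarrow> 'g operation list set" where
  "op_sequences G n s = {ops. length ops = n \<and> (\<forall>x \<in> set ops. valid_op G n s x)}"

definition binary_encoding :: "'g monoid \<Rightarrow> nat \<Rightarrow> ('g \<Rightarrow> bool list) \<Rightarrow> bool" where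
  "binary_encoding G s e \<longleftrightarrow> (\<forall>x \<in> carrier G. length (e x) = s) \<and> inj_on e (carrier G)"

definition range_prod :: "'g monoid \<Rightarrow> (nat \<Rightarrow> 'g) \<Rightarrow> nat \<Rightarrow> nat \<Rightarrow> 'g" where
  "range_prod G a l r = foldr (\<lambda>j x. a j \<otimes>\<^bsub>G\<^esub> x) [l..<Suc r] \<one>\<^bsub>G\<^esub>"

text \<open>The correct answers to the queries, in order, when the current sequence is \<open>a\<close>.\<close>

fun correct_answers ::
    "'g monoid \<Rightarrow> ('g \<Rightarrow> bool list) \<Rightarrow> (nat \<Rightarrow> 'g) \<Rightarrow> 'g operation list \<Rightarrow> bool list" where
  "correct_answers G e a [] = []"
| "correct_answers G e a (Update i b # ops) = correct_answers G e (a(i := b)) ops"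
| "correct_answers G e a (Query l r i # ops) =
     (e (range_prod G a l r) ! i) # correct_answers G e a ops"


section \<open>Data structures\<close>

text \<open>
  Nothing but the memory persists between two operations.  The initial memory is arbitrary, so
  preprocessing is free.
\<close>

datatype 'g data_structure = Data_Structure
  (ds_init: memory)
  (ds_update: "nat \<Rightarrow> 'g \<Rightarrow> unit prog")
  (ds_query: "nat \<Rightarrow> nat \<Rightarrow> nat \<Rightarrow> bool prog")

definition data_structure_for ::
    "'g monoid \<Rightarrow> nat \<Rightarrow> nat \<Rightarrow> nat \<Rightarrow> 'g data_structure \<Rightarrow> bool" where
  "data_structure_for G n s w D \<longleftrightarrow>
     (\<forall>c. ds_init D c < 2 ^ w) \<and>
     (\<forall>i a. valid_op G n s (Update i a) \<longrightarrow> fits w (ds_update D i a)) \<and>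
     (\<forall>l r i. valid_op G n s (Query l r i :: 'g operation) \<longrightarrow> fits w (ds_query D l r i))"

text \<open>The answers given to the queries, in order, and the total number of probes.\<close>

fun run_from :: "'g data_structure \<Rightarrow> memory \<Rightarrow> 'g operation list \<Rightarrow> bool list \<times> nat" where
  "run_from D m [] = ([], 0)"
| "run_from D m (Update i a # ops) =
     (let (_, m', t) = exec (ds_update D i a) m;
          (ys, t') = run_from D m' ops
      in (ys, t + t'))"
| "run_from D m (Query l r i # ops) =
     (let (y, m', t) = exec (ds_query D l r i) m;
          (ys, t') = run_from D m' ops
      in (y # ys, t + t'))"

definition run :: "'g data_structure \<Rightarrow> 'g operation list \<Rightarrow> bool list \<times> nat" where
  "run D ops = run_from D (ds_init D) ops"

definition answers :: "'g data_structure \<Rightarrow> 'g operation list \<Rightarrow> bool list" where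
  "answers D ops = fst (run D ops)"

definition running_time :: "'g data_structure \<Rightarrow> 'g operation list \<Rightarrow> nat" where
  "running_time D ops = snd (run D ops)"

text \<open>Initially, every entry of the stored sequence is the neutral element.\<close>

definition num_correct ::
    "'g monoid \<Rightarrow> ('g \<Rightarrow> bool list) \<Rightarrow> 'g data_structure \<Rightarrow> 'g operation list \<Rightarrow> nat" where
  "num_correct G e D ops =
     length (filter (\<lambda>(x, y). x = y)
       (zip (answers D ops) (correct_answers G e (\<lambda>_. \<one>\<^bsub>G\<^esub>) ops)))"

definition num_queries :: "'g operation list \<Rightarrow> nat" where
  "num_queries ops = length (filter is_query ops)"

definition succeeds ::
    "'g monoid \<Rightarrow> ('g \<Rightarrow> bool list) \<Rightarrow> nat \<Rightarrow> real \<Rightarrow> real \<Rightarrow>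
     'g data_structure \<Rightarrow> 'g operation list \<Rightarrow> bool" where
  "succeeds G e n \<epsilon> \<delta> D ops \<longleftrightarrow>
     real (num_correct G e D ops) \<ge> (1 / 2 + \<delta>) * real (num_queries ops) \<and>
     real (running_time D ops) \<le> \<epsilon> * real n * log 2 (real n)"

text \<open>
  A randomized data structure is a probability measure on deterministic ones.  No particular
  \<open>\<sigma>\<close>-algebra is imposed; it only has to make the observable behaviour on each input measurable.
\<close>

definition randomized_data_structure ::
    "'g monoid \<Rightarrow> nat \<Rightarrow> nat \<Rightarrow> nat \<Rightarrow> 'g data_structure measure \<Rightarrow> bool" where
  "randomized_data_structure G n s w R \<longleftrightarrow>
     prob_space R \<and>
     (\<forall>D \<in> space R. data_structure_for G n s w D) \<and>
     (\<forall>ops \<in> op_sequences G n s. (\<lambda>D. run D ops) \<in> measurable R (count_space UNIV))"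

text \<open>The input is drawn from \<open>\<mu>\<close> independently of the choice of the data structure from \<open>R\<close>.\<close>

definition success_prob ::
    "'g monoid \<Rightarrow> ('g \<Rightarrow> bool list) \<Rightarrow> nat \<Rightarrow> real \<Rightarrow> real \<Rightarrow>
     'g data_structure measure \<Rightarrow> 'g operation list pmf \<Rightarrow> real" where
  "success_prob G e n \<epsilon> \<delta> R \<mu> =
     measure_pmf.expectation \<mu> (\<lambda>ops. measure R {D \<in> space R. succeeds G e n \<epsilon> \<delta> D ops})"

end

theory Submission
  imports Defs
begin

text \<open>
  The hard input consists of about \<open>n / 2\<close> steps, each of which sets the position given by the
  bit-reversal permutation to a random group element and then asks for a random bit of the product of
  the prefix ending there.  View time as a binary tree.  At a node, the prefix products queried in the
  right half determine the elements written in the left half, so they are uniform and independent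
  given everything else.  The right half is simulated from the memory before the left half; a read
  that shows the difference is a transfer.  Along the simulation we keep a set \<open>S\<close> of candidates for
  the left half and bound exponential moments of (number of correct answers) \<open>- K\<close> (number of
  transfers) by \<open>|S| powr (1 - 1 / s)\<close>.  By Hoelder's inequality with exponent \<open>s\<close>, the fee \<open>K\<close> pays
  for the information in a transfer, and an answer given without a transfer, which cannot depend on
  the candidate, is right for a random bit only about half of the time.  Since a probe is a transfer
  at no more than one level of the tree and a typical query lies in a right half at half of the levels,
  averaging over the levels and Markov's inequality give the tail bound, without any union bound.
\<close>

section \<open>Programs\<close>

definition val :: "'r prog \<Rightarrow> memory \<Rightarrow> 'r" where
  "val q m = fst (exec q m)"

definition mem :: "'r prog \<Rightarrow> memory \<Rightarrow> memory" where
  "mem q m = fst (snd (exec q m))"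

definition cost :: "'r prog \<Rightarrow> memory \<Rightarrow> nat" where
  "cost q m = snd (snd (exec q m))"

lemma exec_eq: "exec q m = (val q m, mem q m, cost q m)"
  by (simp add: val_def mem_def cost_def)

lemma val_simps [simp]:
  "val (Return x) m = x"
  "val (Read c k) m = val (k (m c)) m"
  "val (Write c v q) m = val q (m(c := v))"
  by (simp_all add: val_def split_beta)

lemma mem_simps [simp]:
  "mem (Return x) m = m"
  "mem (Read c k) m = mem (k (m c)) m"
  "mem (Write c v q) m = mem q (m(c := v))"
  by (simp_all add: mem_def split_beta)

lemma cost_simps [simp]:
  "cost (Return x) m = 0"
  "cost (Read c k) m = Suc (cost (k (m c)) m)"
  "cost (Write c v q) m = Suc (cost q (m(c := v)))"
  by (simp_all add: cost_def split_beta)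

primrec accessed :: "'r prog \<Rightarrow> memory \<Rightarrow> nat set" where
  "accessed (Return x) m = {}"
| "accessed (Read c k) m = insert c (accessed (k (m c)) m)"
| "accessed (Write c v q) m = insert c (accessed q (m(c := v)))"

text \<open>The number of cells of \<open>\<Delta>\<close> whose first access is a read.\<close>

primrec transfers :: "'r prog \<Rightarrow> memory \<Rightarrow> nat set \<Rightarrow> nat" where
  "transfers (Return x) m \<Delta> = 0"
| "transfers (Read c k) m \<Delta> = of_bool (c \<in> \<Delta>) + transfers (k (m c)) m (\<Delta> - {c})"
| "transfers (Write c v q) m \<Delta> = transfers q (m(c := v)) (\<Delta> - {c})"

lemma mem_not_accessed: "c \<notin> accessed q m \<Longrightarrow> mem q m c = m c"
  by (induction q arbitrary: m) auto

lemma transfers_le_cost: "transfers q m \<Delta> \<le> cost q m"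
proof (induction q arbitrary: m \<Delta>)
  case (Read c k)
  then show ?case by (auto simp: of_bool_def le_SucI)
next
  case (Write c v q)
  then show ?case by (auto intro: le_SucI)
qed auto

text \<open>A counted read belongs to at most one of two disjoint sets. This later lets a node of
  the tree and its ancestors share the probes of one run.\<close>

lemma transfers_Un:
  "A \<inter> B = {} \<Longrightarrow> transfers q m (A \<union> B) = transfers q m A + transfers q m B"
proof (induction q arbitrary: m A B)
  case (Read c k)
  have "transfers (k (m c)) m ((A - {c}) \<union> (B - {c}))
      = transfers (k (m c)) m (A - {c}) + transfers (k (m c)) m (B - {c})"
    using Read.prems by (intro Read.IH) auto
  moreover have "(A - {c}) \<union> (B - {c}) = A \<union> B - {c}" by auto
  ultimately show ?case using Read.prems by (auto simp: of_bool_def)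
next
  case (Write c v q)
  have "transfers q (m(c := v)) ((A - {c}) \<union> (B - {c}))
      = transfers q (m(c := v)) (A - {c}) + transfers q (m(c := v)) (B - {c})"
    using Write.prems by (intro Write.IH) auto
  moreover have "(A - {c}) \<union> (B - {c}) = A \<union> B - {c}" by auto
  ultimately show ?case by simp
qed auto

primrec bind_prog :: "'r prog \<Rightarrow> ('r \<Rightarrow> 't prog) \<Rightarrow> 't prog" where
  "bind_prog (Return x) f = f x"
| "bind_prog (Read c k) f = Read c (\<lambda>v. bind_prog (k v) f)"
| "bind_prog (Write c v q) f = Write c v (bind_prog q f)"

lemma val_bind_prog [simp]: "val (bind_prog q f) m = val (f (val q m)) (mem q m)"
  by (induction q arbitrary: m) auto

lemma mem_bind_prog [simp]: "mem (bind_prog q f) m = mem (f (val q m)) (mem q m)"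
  by (induction q arbitrary: m) auto

lemma cost_bind_prog [simp]: "cost (bind_prog q f) m = cost q m + cost (f (val q m)) (mem q m)"
  by (induction q arbitrary: m) auto

lemma accessed_bind_prog [simp]:
  "accessed (bind_prog q f) m = accessed q m \<union> accessed (f (val q m)) (mem q m)"
  by (induction q arbitrary: m) auto

lemma transfers_bind_prog [simp]:
  "transfers (bind_prog q f) m \<Delta> =
     transfers q m \<Delta> + transfers (f (val q m)) (mem q m) (\<Delta> - accessed q m)"
  by (induction q arbitrary: m \<Delta>) (auto simp: Diff_insert2[symmetric])

lemma fits_bind_prog: "fits w q \<Longrightarrow> (\<And>x. fits w (f x)) \<Longrightarrow> fits w (bind_prog q f)"
  by (induction q) auto

definition word_memory :: "nat \<Rightarrow> memory \<Rightarrow> bool" where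
  "word_memory w m \<longleftrightarrow> (\<forall>c. m c < 2 ^ w)"

lemma word_memory_mem: "fits w q \<Longrightarrow> word_memory w m \<Longrightarrow> word_memory w (mem q m)"
proof (induction q arbitrary: m)
  case (Read c k)
  then have "m c < 2 ^ w" by (simp add: word_memory_def)
  with Read show ?case by auto
next
  case (Write c v q)
  then have "word_memory w (m(c := v))" by (simp add: word_memory_def)
  with Write show ?case by auto
qed auto


section \<open>The simulation inequality\<close>

lemma weighted_Young:
  fixes a b :: real
  assumes "a \<ge> 0" "b \<ge> 0" "s > 0"
  shows "a powr (1 - 1 / real s) * b powr (1 / real s) \<le> (1 - 1 / real s) * a + 1 / real s * b"
proof (cases "a = 0 \<or> b = 0")
  \<comment> \<open>Since \<open>0 powr x = 0\<close> for every \<open>x\<close>, including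
    \<open>x = 0\<close>, the left side vanishes here even when \<open>s = 1\<close>.\<close>
  case True
  then show ?thesis
    using assms mult_left_mono[of 1 "real s" a] by (auto simp: field_simps)
next
  case False
  then show ?thesis using assms
    by (intro Youngs_inequality_0) (auto simp: field_simps)
qed

text \<open>Once both sums are normalised to 1, Young's inequality holds term by term. Of
  \<open>u\<close> only the \<open>s\<close>-th powers enter the bound; they are what the fee and
  the encoding control.\<close>

lemma Holder_sum:
  fixes x u :: "'i \<Rightarrow> real"
  assumes fin: "finite I" and s: "s > 0"
    and x: "\<And>i. i \<in> I \<Longrightarrow> x i \<ge> 0" and u: "\<And>i. i \<in> I \<Longrightarrow> u i \<ge> 0"
  shows "(\<Sum>i\<in>I. x i powr (1 - 1 / real s) * u i)
    \<le> (\<Sum>i\<in>I. x i) powr (1 - 1 / real s) * (\<Sum>i\<in>I. u i ^ s) powr (1 / real s)"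
proof (cases "(\<Sum>i\<in>I. x i) = 0 \<or> (\<Sum>i\<in>I. u i ^ s) = 0")
  case True
  then have "(\<forall>i\<in>I. x i = 0) \<or> (\<forall>i\<in>I. u i = 0)"
    using sum_nonneg_eq_0_iff[OF fin, of x] sum_nonneg_eq_0_iff[OF fin, of "\<lambda>i. u i ^ s"] x u s
    by auto
  then have "(\<Sum>i\<in>I. x i powr (1 - 1 / real s) * u i) = 0"
    by (auto intro!: sum.neutral)
  then show ?thesis by simp
next
  case False
  define X where "X = (\<Sum>i\<in>I. x i)"
  define U where "U = (\<Sum>i\<in>I. u i ^ s)"
  have "X \<ge> 0" "U \<ge> 0" unfolding X_def U_def using x u by (auto intro: sum_nonneg)
  with False have pos: "X > 0" "U > 0" by (auto simp: X_def U_def)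
  have summand: "x i powr (1 - 1 / real s) * u i \<le> X powr (1 - 1 / real s) * U powr (1 / real s) *
      ((1 - 1 / real s) * (x i / X) + 1 / real s * (u i ^ s / U))" if i: "i \<in> I" for i
  proof -
    have ui: "(u i ^ s) powr (1 / real s) = u i"
      using u[OF i] s by (cases "u i = 0") (simp_all add: powr_realpow[symmetric] powr_powr)
    have "(x i / X) powr (1 - 1 / real s) * (u i ^ s / U) powr (1 / real s)
       \<le> (1 - 1 / real s) * (x i / X) + 1 / real s * (u i ^ s / U)"
      using pos x[OF i] u[OF i] s by (intro weighted_Young) auto
    moreover have "(x i / X) powr (1 - 1 / real s) * (u i ^ s / U) powr (1 / real s)
       = x i powr (1 - 1 / real s) * u i / (X powr (1 - 1 / real s) * U powr (1 / real s))"
      using pos x[OF i] u[OF i] by (simp add: powr_divide ui)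
    moreover have "X powr (1 - 1 / real s) * U powr (1 / real s) > 0" using pos by simp
    ultimately show ?thesis by (simp add: divide_le_eq mult.commute)
  qed
  have "(\<Sum>i\<in>I. x i powr (1 - 1 / real s) * u i) \<le> (\<Sum>i\<in>I. X powr (1 - 1 / real s) * U powr (1 / real s) *
      ((1 - 1 / real s) * (x i / X) + 1 / real s * (u i ^ s / U)))"
    by (intro sum_mono summand)
  also have "\<dots> = X powr (1 - 1 / real s) * U powr (1 / real s) *
      ((1 - 1 / real s) * ((\<Sum>i\<in>I. x i) / X) + 1 / real s * ((\<Sum>i\<in>I. u i ^ s) / U))"
    by (simp add: sum_distrib_left[symmetric] sum.distrib sum_divide_distrib[symmetric])
  also have "\<dots> = X powr (1 - 1 / real s) * U powr (1 / real s)"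
    using pos by (simp add: X_def[symmetric] U_def[symmetric])
  finally show ?thesis by (simp add: X_def U_def)
qed

text \<open>
  A run on the memory \<open>M p\<close> is simulated from the memory \<open>b\<close>, which does not depend on \<open>p\<close>: a read
  of a cell on which the two memories disagree is a transfer, after which \<open>b\<close> is corrected.  Every
  value that is read splits the set \<open>S\<close> of candidates; the fee \<open>K\<close> per transfer and the fee
  \<open>\<eta>\<close> per probe pay for the split, and the answer \<open>val q b\<close> of the run without transfers is
  the only one that matters.
\<close>

lemma sum_simulation_le:
  fixes V :: "'p \<Rightarrow> memory \<Rightarrow> nat set \<Rightarrow> real" and H :: "'r \<Rightarrow> real"
  assumes s: "s > 0"
    and fee: "1 + 2 ^ w * exp (\<theta> - K) ^ s \<le> exp \<eta> ^ s"
    and H: "\<And>y y'. 0 \<le> H y \<and> H y \<le> exp \<theta> * H y'"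
    and B: "B \<ge> 0" and \<eta>: "\<eta> \<ge> 0"
    and V: "\<And>S' M' b'. S' \<subseteq> S \<Longrightarrow> (\<And>p. p \<in> S' \<Longrightarrow> word_memory w (M' p)) \<Longrightarrow> word_memory w b' \<Longrightarrow>
      (\<Sum>p\<in>S'. V p (M' p) {c. M' p c \<noteq> b' c}) \<le> B * real (card S') powr (1 - 1 / real s)"
    and V_nonneg: "\<And>p m \<Delta>. V p m \<Delta> \<ge> 0"
    and q: "fits w q" and fin: "finite S"
    and M: "\<And>p. p \<in> S \<Longrightarrow> word_memory w (M p)" and b: "word_memory w b"
  shows "(\<Sum>p\<in>S. H (val q (M p)) *
      exp (- K * real (transfers q (M p) {c. M p c \<noteq> b c}) - \<eta> * real (cost q (M p))) *
      V p (mem q (M p)) ({c. M p c \<noteq> b c} - accessed q (M p)))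
    \<le> H (val q b) * B * real (card S) powr (1 - 1 / real s)"
  using q fin M b V
proof (induction q arbitrary: S M b)
  case (Return x)
  have "(\<Sum>p\<in>S. H x * V p (M p) {c. M p c \<noteq> b c}) = H x * (\<Sum>p\<in>S. V p (M p) {c. M p c \<noteq> b c})"
    by (simp add: sum_distrib_left)
  also have "\<dots> \<le> H x * (B * real (card S) powr (1 - 1 / real s))"
    using H[of x x] Return.prems by (intro mult_left_mono) auto
  finally show ?case by (simp add: mult.assoc)
next
  case (Write c v q)
  have "(\<Sum>p\<in>S. H (val q ((M p)(c := v))) *
      exp (- K * real (transfers q ((M p)(c := v)) {c'. ((M p)(c := v)) c' \<noteq> (b(c := v)) c'})
         - \<eta> * real (cost q ((M p)(c := v)))) *
      V p (mem q ((M p)(c := v))) ({c'. ((M p)(c := v)) c' \<noteq> (b(c := v)) c'} - accessed q ((M p)(c := v))))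
    \<le> H (val q (b(c := v))) * B * real (card S) powr (1 - 1 / real s)" (is "?A \<le> _")
    using Write.prems by (intro Write.IH) (auto simp: word_memory_def)
  moreover have "(\<Sum>p\<in>S. H (val (Write c v q) (M p)) *
      exp (- K * real (transfers (Write c v q) (M p) {c. M p c \<noteq> b c}) - \<eta> * real (cost (Write c v q) (M p))) *
      V p (mem (Write c v q) (M p)) ({c. M p c \<noteq> b c} - accessed (Write c v q) (M p))) \<le> ?A"
  proof (intro sum_mono)
    fix p assume "p \<in> S"
    \<comment> \<open>All runs write the same word, so every memory agrees with the simulated one on
      \<open>c\<close> afterwards. The fee for this probe is simply dropped.\<close>
    have \<Delta>: "{c'. ((M p)(c := v)) c' \<noteq> (b(c := v)) c'} = {c. M p c \<noteq> b c} - {c}" by auto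
    show "H (val (Write c v q) (M p)) *
      exp (- K * real (transfers (Write c v q) (M p) {c. M p c \<noteq> b c}) - \<eta> * real (cost (Write c v q) (M p))) *
      V p (mem (Write c v q) (M p)) ({c. M p c \<noteq> b c} - accessed (Write c v q) (M p))
      \<le> H (val q ((M p)(c := v))) *
      exp (- K * real (transfers q ((M p)(c := v)) {c'. ((M p)(c := v)) c' \<noteq> (b(c := v)) c'})
         - \<eta> * real (cost q ((M p)(c := v)))) *
      V p (mem q ((M p)(c := v))) ({c'. ((M p)(c := v)) c' \<noteq> (b(c := v)) c'} - accessed q ((M p)(c := v)))"
      unfolding \<Delta> transfers.simps val_simps mem_simps accessed.simps cost_simps Diff_insert2[symmetric]
      using \<eta> H V_nonneg
      by (intro mult_right_mono mult_left_mono) (simp_all add: algebra_simps)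
  qed
  ultimately show ?case by simp
next
  case (Read c k)
  define S' where "S' v = {p \<in> S. M p c = v}" for v
  \<comment> \<open>The weight of reading \<open>v\<close>: an unexpected value pays
    \<open>exp (- K)\<close> as a transfer, while the changed prediction of the answer loses at most
    a factor \<open>exp \<theta>\<close>.\<close>
  define u where "u v = (if v = b c then 1 else exp (\<theta> - K))" for v
  define f where "f p = H (val (Read c k) (M p)) *
      exp (- K * real (transfers (Read c k) (M p) {c. M p c \<noteq> b c}) - \<eta> * real (cost (Read c k) (M p))) *
      V p (mem (Read c k) (M p)) ({c. M p c \<noteq> b c} - accessed (Read c k) (M p))" for p
  define E where "E = 1 - 1 / real s"
  let ?W = "H (val (k (b c)) b) * B"
  have W0: "?W \<ge> 0" using H B by simp
  have bc: "b c < 2 ^ w" using Read.prems by (auto simp: word_memory_def)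
  have fees: "exp (- K * real (of_bool P + t) - \<eta> * real (Suc n))
      = exp (-\<eta>) * (if P then exp (-K) else 1) * exp (- K * real t - \<eta> * real n)" for P t n
    by (simp add: exp_add[symmetric] algebra_simps)
  have part: "(\<Sum>p\<in>S' v. f p) \<le> exp (-\<eta>) * ?W * (real (card (S' v)) powr E * u v)" if v: "v < 2 ^ w" for v
  proof -
    \<comment> \<open>All candidates in \<open>S' v\<close> hold \<open>v\<close> in
      \<open>c\<close>, so this correction of the simulated memory removes \<open>c\<close> from the
      differences.\<close>
    let ?b = "b(c := v)"
    have IH: "(\<Sum>p\<in>S' v. H (val (k v) (M p)) *
      exp (- K * real (transfers (k v) (M p) {c. M p c \<noteq> ?b c}) - \<eta> * real (cost (k v) (M p))) *
      V p (mem (k v) (M p)) ({c. M p c \<noteq> ?b c} - accessed (k v) (M p)))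
    \<le> H (val (k v) ?b) * B * real (card (S' v)) powr E" (is "?A \<le> _")
      unfolding E_def using Read.prems(1-4) v
      by (intro Read.IH Read.prems(5)) (auto simp: word_memory_def S'_def)
    have "(\<Sum>p\<in>S' v. f p) = exp (-\<eta>) * (if v = b c then 1 else exp (-K)) * ?A"
      unfolding sum_distrib_left
    proof (intro sum.cong refl)
      fix p assume "p \<in> S' v"
      then have p: "M p c = v" by (simp add: S'_def)
      have \<Delta>: "{c'. M p c' \<noteq> ?b c'} = {c. M p c \<noteq> b c} - {c}" using p by auto
      show "f p = exp (-\<eta>) * (if v = b c then 1 else exp (-K)) * (H (val (k v) (M p)) *
      exp (- K * real (transfers (k v) (M p) {c. M p c \<noteq> ?b c}) - \<eta> * real (cost (k v) (M p))) *
      V p (mem (k v) (M p)) ({c. M p c \<noteq> ?b c} - accessed (k v) (M p)))"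
        unfolding \<Delta> f_def using p fees[of "v \<noteq> b c"]
        by (cases "v = b c") (simp_all add: Diff_insert2[symmetric])
    qed
    also have "\<dots> \<le> exp (-\<eta>) * (if v = b c then 1 else exp (-K)) *
        (H (val (k v) ?b) * B * real (card (S' v)) powr E)"
      using IH by (intro mult_left_mono) auto
    also have "(if v = b c then 1 else exp (-K)) * H (val (k v) ?b) \<le> u v * H (val (k (b c)) b)"
    proof (cases "v = b c")
      case True
      then show ?thesis by (simp add: u_def fun_upd_idem)
    next
      case False
      have "exp (-K) * H (val (k v) ?b) \<le> exp (-K) * (exp \<theta> * H (val (k (b c)) b))"
        using H by (intro mult_left_mono) auto
      then show ?thesis using False by (simp add: u_def exp_diff exp_minus field_simps)
    qed
    then have "exp (-\<eta>) * (if v = b c then 1 else exp (-K)) *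
        (H (val (k v) ?b) * B * real (card (S' v)) powr E)
       \<le> exp (-\<eta>) * ?W * (real (card (S' v)) powr E * u v)"
      using B
      by (auto intro: mult_right_mono simp: mult_ac
           dest: mult_right_mono[where c="exp (-\<eta>) * B * real (card (S' v)) powr E"])
    finally show ?thesis .
  qed
  have S_eq: "S = (\<Union>v\<in>{..<2 ^ w}. S' v)"
    using Read.prems by (auto simp: S'_def word_memory_def)
  have fin': "finite (S' v)" for v using Read.prems by (auto simp: S'_def)
  have "(\<Sum>p\<in>S. f p) = (\<Sum>v<2 ^ w. \<Sum>p\<in>S' v. f p)"
    unfolding S_eq by (intro sum.UNION_disjoint) (use fin' in \<open>auto simp: S'_def\<close>)
  also have "\<dots> \<le> (\<Sum>v<2 ^ w. exp (-\<eta>) * ?W * (real (card (S' v)) powr E * u v))"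
    by (intro sum_mono part) auto
  also have "\<dots> = exp (-\<eta>) * ?W * (\<Sum>v<2 ^ w. real (card (S' v)) powr E * u v)"
    by (simp add: sum_distrib_left)
  \<comment> \<open>Only \<open>b c\<close> has weight 1 and fewer than \<open>2 ^ w\<close> values
    have weight \<open>exp (\<theta> - K)\<close>. So \<open>fee\<close> bounds the second factor by
    \<open>exp \<eta>\<close>, which the fee for the probe cancels.\<close>
  also have "(\<Sum>v<2 ^ w. real (card (S' v)) powr E * u v)
      \<le> (\<Sum>v<2 ^ w. real (card (S' v))) powr E * (\<Sum>v<2 ^ w. u v ^ s) powr (1 / real s)"
    unfolding E_def by (rule Holder_sum) (auto simp: s u_def)
  also have "(\<Sum>v<2 ^ w. real (card (S' v))) = real (card S)"
    unfolding S_eq by (subst card_UN_disjoint) (use fin' in \<open>auto simp: S'_def\<close>)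
  also have "(\<Sum>v<2 ^ w. u v ^ s) powr (1 / real s) \<le> exp \<eta>"
  proof -
    have "(\<Sum>v<2 ^ w. u v ^ s) = u (b c) ^ s + (\<Sum>v\<in>{..<2 ^ w} - {b c}. u v ^ s)"
      using bc by (subst sum.remove[of _ "b c"]) auto
    also have "(\<Sum>v\<in>{..<2 ^ w} - {b c}. u v ^ s) = (\<Sum>v\<in>{..<(2::nat) ^ w} - {b c}. exp (\<theta> - K) ^ s)"
      by (intro sum.cong) (auto simp: u_def)
    also have "\<dots> \<le> 2 ^ w * exp (\<theta> - K) ^ s"
    proof -
      have "real (card ({..<(2::nat) ^ w} - {b c})) \<le> real (2 ^ w)"
        by (intro of_nat_mono) (metis card_lessThan card_mono Diff_subset finite_lessThan)
      then have "real (card ({..<(2::nat) ^ w} - {b c})) * exp (\<theta> - K) ^ s \<le> real (2 ^ w) * exp (\<theta> - K) ^ s"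
        by (intro mult_right_mono) auto
      then show ?thesis by simp
    qed
    finally have "(\<Sum>v<2 ^ w. u v ^ s) \<le> exp \<eta> ^ s" using fee by (simp add: u_def)
    then have "(\<Sum>v<2 ^ w. u v ^ s) powr (1 / real s) \<le> (exp \<eta> ^ s) powr (1 / real s)"
      by (intro powr_mono2 sum_nonneg) (auto simp: u_def)
    also have "(exp \<eta> ^ s) powr (1 / real s) = exp \<eta>"
      using s by (simp add: exp_of_nat_mult[symmetric] powr_def)
    finally show ?thesis .
  qed
  finally have "(\<Sum>p\<in>S. f p) \<le> exp (-\<eta>) * ?W * (real (card S) powr E * exp \<eta>)"
    using W0 by (simp add: mult_left_mono)
  also have "\<dots> = ?W * real (card S) powr E" by (simp add: exp_minus)
  finally show ?case by (simp add: f_def E_def)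
qed


section \<open>Sums over lists\<close>

definition lists_of :: "'a set \<Rightarrow> nat \<Rightarrow> 'a list set" where
  "lists_of A n = {xs. set xs \<subseteq> A \<and> length xs = n}"

lemma finite_lists_of: "finite A \<Longrightarrow> finite (lists_of A n)"
  by (simp add: lists_of_def finite_lists_length_eq)

lemma card_lists_of: "finite A \<Longrightarrow> card (lists_of A n) = card A ^ n"
  by (simp add: lists_of_def card_lists_length_eq)

lemma lists_of_0 [simp]: "lists_of A 0 = {[]}"
  by (auto simp: lists_of_def)

lemma sum_lists_of_Suc:
  "(\<Sum>xs\<in>lists_of A (Suc n). f xs) = (\<Sum>x\<in>A. \<Sum>xs\<in>lists_of A n. f (x # xs))"
proof -
  have eq: "lists_of A (Suc n) = (\<lambda>(x, xs). x # xs) ` (A \<times> lists_of A n)"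
    by (force simp: lists_of_def length_Suc_conv)
  have "(\<Sum>xs\<in>lists_of A (Suc n). f xs) = sum (f \<circ> (\<lambda>(x, xs). x # xs)) (A \<times> lists_of A n)"
    unfolding eq by (rule sum.reindex) (auto simp: inj_on_def)
  then show ?thesis by (simp add: sum.cartesian_product split_def o_def)
qed

lemma sum_lists_of_add:
  "(\<Sum>xs\<in>lists_of A (m + n). f xs) = (\<Sum>xs\<in>lists_of A m. \<Sum>ys\<in>lists_of A n. f (xs @ ys))"
  by (induction m arbitrary: f) (simp_all add: sum_lists_of_Suc)

lemma sum_lists_of_prod:
  fixes c :: "nat \<Rightarrow> 'a \<Rightarrow> real"
  shows "(\<Sum>xs\<in>lists_of A n. \<Prod>i<n. c i (xs ! i)) = (\<Prod>i<n. \<Sum>x\<in>A. c i x)"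
proof (induction n arbitrary: c)
  case (Suc n)
  have "(\<Sum>xs\<in>lists_of A (Suc n). \<Prod>i<Suc n. c i (xs ! i))
      = (\<Sum>x\<in>A. c 0 x * (\<Sum>xs\<in>lists_of A n. \<Prod>i<n. c (Suc i) (xs ! i)))"
    by (simp add: sum_lists_of_Suc prod.lessThan_Suc_shift sum_distrib_left del: prod.lessThan_Suc)
  also have "\<dots> = (\<Prod>i<Suc n. \<Sum>x\<in>A. c i x)"
    by (simp add: Suc.IH[of "\<lambda>i. c (Suc i)"] prod.lessThan_Suc_shift sum_distrib_right del: prod.lessThan_Suc)
  finally show ?case .
qed simp


section \<open>Agreement with a fixed prediction\<close>

lemma exp_le_quadratic:
  fixes x :: real
  assumes "\<bar>x\<bar> \<le> 1"
  shows "exp x \<le> 1 + x + x\<^sup>2"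
proof (cases "x \<ge> 0")
  case True
  then show ?thesis using exp_bound[of x] assms by simp
next
  case False
  define y where "y = - x"
  have y: "y > 0" using False by (simp add: y_def)
  have "exp x = 1 / exp y" by (simp add: y_def exp_minus inverse_eq_divide)
  also have "\<dots> \<le> 1 / (1 + y)" using y exp_ge_add_one_self[of y] by (intro divide_left_mono) auto
  also have "\<dots> \<le> 1 - y + y\<^sup>2"
  proof -
    have "(1 - y + y\<^sup>2) * (1 + y) = 1 + y ^ 3" by (simp add: algebra_simps power2_eq_square power3_eq_cube)
    then show ?thesis using y by (simp add: divide_le_eq)
  qed
  finally show ?thesis by (simp add: y_def)
qed

text \<open>The factor that one answer contributes to an exponential moment. The scores
  \<open>1 / 2\<close> and \<open>- 1 / 2\<close> are centred so that the first-order terms cancel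
  over the two values of the correct bit.\<close>

definition gain :: "real \<Rightarrow> bool \<Rightarrow> bool \<Rightarrow> real" where
  "gain \<theta> y t = exp (if y = t then \<theta> / 2 else - \<theta> / 2)"

lemma gain_nonneg [simp]: "gain \<theta> y t \<ge> 0"
  by (simp add: gain_def)

text \<open>With exponents of absolute value \<open>\<theta> / 2\<close>, the arithmetic mean of the
  gains exceeds their geometric mean by at most a factor \<open>exp (\<theta>\<^sup>2 / 4)\<close>.
  The \<open>s\<close>-th power turns the geometric mean into a product over the bits.\<close>

lemma sum_gain_le:
  assumes "0 \<le> \<theta>" "\<theta> \<le> 1"
  shows "(\<Sum>i<s. gain \<theta> (y i) (t i)) ^ s \<le> (real s * exp (\<theta>\<^sup>2 / 4)) ^ s * (\<Prod>i<s. gain \<theta> (y i) (t i))"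
proof (cases "s = 0")
  case False
  define \<sigma> where "\<sigma> i = (if y i = t i then \<theta> / 2 else - \<theta> / 2)" for i
  have gain: "gain \<theta> (y i) (t i) = exp (\<sigma> i)" for i
    by (simp add: gain_def \<sigma>_def)
  have "(\<Sum>i<s. exp (\<sigma> i)) \<le> (\<Sum>i<s. 1 + \<sigma> i + \<theta>\<^sup>2 / 4)"
  proof (intro sum_mono)
    fix i
    have "exp (\<sigma> i) \<le> 1 + \<sigma> i + (\<sigma> i)\<^sup>2"
      using assms by (intro exp_le_quadratic) (auto simp: \<sigma>_def)
    then show "exp (\<sigma> i) \<le> 1 + \<sigma> i + \<theta>\<^sup>2 / 4"
      by (auto simp: \<sigma>_def power2_eq_square)
  qed
  also have "\<dots> = s * (1 + ((\<Sum>i<s. \<sigma> i) / s + \<theta>\<^sup>2 / 4))"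
  proof -
    have "(\<Sum>i<s. 1 + \<sigma> i + \<theta>\<^sup>2 / 4) = s + (\<Sum>i<s. \<sigma> i) + s * (\<theta>\<^sup>2 / 4)"
      by (simp add: sum.distrib)
    then show ?thesis using False by (simp add: field_simps)
  qed
  also have "\<dots> \<le> s * exp ((\<Sum>i<s. \<sigma> i) / s + \<theta>\<^sup>2 / 4)"
    by (intro mult_left_mono exp_ge_add_one_self) auto
  also have "\<dots> = s * exp (\<theta>\<^sup>2 / 4) * exp ((\<Sum>i<s. \<sigma> i) / s)"
    by (simp add: exp_add)
  finally have "(\<Sum>i<s. exp (\<sigma> i)) ^ s \<le> (s * exp (\<theta>\<^sup>2 / 4) * exp ((\<Sum>i<s. \<sigma> i) / s)) ^ s"
    by (intro power_mono sum_nonneg) auto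
  also have "\<dots> = (s * exp (\<theta>\<^sup>2 / 4)) ^ s * exp ((\<Sum>i<s. \<sigma> i) / s) ^ s"
    by (rule power_mult_distrib)
  also have "exp ((\<Sum>i<s. \<sigma> i) / s) ^ s = exp (\<Sum>i<s. \<sigma> i)"
    using False by (simp add: exp_of_nat_mult[symmetric])
  also have "\<dots> = (\<Prod>i<s. exp (\<sigma> i))" by (rule exp_sum) simp
  finally show ?thesis by (simp add: gain)
qed simp

text \<open>
  Injectivity of \<open>e\<close> replaces the sum over the group by a sum over all bit strings, which factorises.
\<close>

lemma sum_encoding_gain_le:
  assumes e: "binary_encoding G s e" and fin: "finite (carrier G)"
    and \<theta>: "0 \<le> \<theta>" "\<theta> \<le> 1"
  shows "(\<Sum>g\<in>carrier G. (\<Sum>i<s. gain \<theta> (y i) (e g ! i)) ^ s) \<le> (real s * (2 * exp (\<theta>\<^sup>2 / 2))) ^ s"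
proof -
  let ?c = "(real s * exp (\<theta>\<^sup>2 / 4)) ^ s"
  have two: "(\<Sum>t\<in>UNIV. gain \<theta> (y i) t) \<le> 2 * exp (\<theta>\<^sup>2 / 4)" for i
  proof -
    have "(\<Sum>t\<in>UNIV. gain \<theta> (y i) t) = exp (\<theta> / 2) + exp (- \<theta> / 2)"
      by (auto simp: UNIV_bool gain_def)
    also have "\<dots> \<le> (1 + \<theta> / 2 + (\<theta> / 2)\<^sup>2) + (1 + (- \<theta> / 2) + (- \<theta> / 2)\<^sup>2)"
      using \<theta> by (intro add_mono exp_le_quadratic) auto
    also have "\<dots> = 2 * (1 + \<theta>\<^sup>2 / 4)" by (simp add: power2_eq_square)
    also have "\<dots> \<le> 2 * exp (\<theta>\<^sup>2 / 4)"
      using exp_ge_add_one_self[of "\<theta>\<^sup>2 / 4"] by (intro mult_left_mono) auto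
    finally show ?thesis .
  qed
  have "(\<Sum>g\<in>carrier G. (\<Sum>i<s. gain \<theta> (y i) (e g ! i)) ^ s)
      \<le> (\<Sum>g\<in>carrier G. ?c * (\<Prod>i<s. gain \<theta> (y i) (e g ! i)))"
    using \<theta> by (intro sum_mono sum_gain_le)
  also have "\<dots> = ?c * (\<Sum>z\<in>e ` carrier G. \<Prod>i<s. gain \<theta> (y i) (z ! i))"
    using e by (simp add: sum_distrib_left binary_encoding_def sum.reindex)
  also have "\<dots> \<le> ?c * (\<Sum>z\<in>lists_of UNIV s. \<Prod>i<s. gain \<theta> (y i) (z ! i))"
    using e by (intro mult_left_mono sum_mono2 finite_lists_of prod_nonneg zero_le_power)
      (auto simp: binary_encoding_def lists_of_def)
  also have "\<dots> = ?c * (\<Prod>i<s. \<Sum>t\<in>UNIV. gain \<theta> (y i) t)"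
    by (subst sum_lists_of_prod) rule
  also have "\<dots> \<le> ?c * (\<Prod>i<s. 2 * exp (\<theta>\<^sup>2 / 4))"
    by (intro mult_left_mono prod_mono conjI two sum_nonneg zero_le_power) auto
  also have "\<dots> = (real s * (2 * (exp (\<theta>\<^sup>2 / 4) * exp (\<theta>\<^sup>2 / 4)))) ^ s"
    by (simp add: power_mult_distrib)
  also have "exp (\<theta>\<^sup>2 / 4) * exp (\<theta>\<^sup>2 / 4) = exp (\<theta>\<^sup>2 / 2)"
    by (simp add: exp_add[symmetric])
  finally show ?thesis .
qed


section \<open>Sequences of update-query pairs\<close>

primrec steps_prog :: "(nat \<Rightarrow> 'g \<Rightarrow> nat \<Rightarrow> bool prog) \<Rightarrow> (nat \<times> 'g \<times> nat) list \<Rightarrow> bool list prog" where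
  "steps_prog Q [] = Return []"
| "steps_prog Q (u # us) =
     bind_prog (case u of (x, g, i) \<Rightarrow> Q x g i)
       (\<lambda>y. bind_prog (steps_prog Q us) (\<lambda>ys. Return (y # ys)))"

fun truths :: "'g monoid \<Rightarrow> ('g \<Rightarrow> bool list) \<Rightarrow> (nat \<Rightarrow> 'g) \<Rightarrow> (nat \<times> 'g \<times> nat) list \<Rightarrow> bool list" where
  "truths G e a [] = []"
| "truths G e a ((x, g, i) # us) = (e (range_prod G (a(x := g)) 0 x) ! i) # truths G e (a(x := g)) us"

fun prefixes :: "'g monoid \<Rightarrow> (nat \<Rightarrow> 'g) \<Rightarrow> (nat \<times> 'g \<times> nat) list \<Rightarrow> 'g list" where
  "prefixes G a [] = []"
| "prefixes G a ((x, g, i) # us) = range_prod G (a(x := g)) 0 x # prefixes G (a(x := g)) us"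

fun store :: "(nat \<Rightarrow> 'g) \<Rightarrow> (nat \<times> 'g \<times> nat) list \<Rightarrow> nat \<Rightarrow> 'g" where
  "store a [] = a"
| "store a ((x, g, i) # us) = store (a(x := g)) us"

definition advantage :: "bool list \<Rightarrow> bool list \<Rightarrow> real" where
  "advantage ys ts = (\<Sum>(y, t)\<leftarrow>zip ys ts. if y = t then 1 / 2 else - 1 / 2)"

lemma advantage_Nil [simp]: "advantage [] [] = 0"
  by (simp add: advantage_def)

lemma advantage_Cons [simp]:
  "advantage (y # ys) (t # ts) = (if y = t then 1 / 2 else - 1 / 2) + advantage ys ts"
  by (simp add: advantage_def)

text \<open>\<open>Q x g i\<close> stands for one update-query pair. \<open>fee\<close> says that
  the fee \<open>K\<close> per transfer outweighs the \<open>2 ^ w\<close> possible words of a cell,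
  measured in the \<open>s\<close>-th powers that Hoelder's inequality produces.\<close>

locale simulation = group G for G :: "'g monoid" (structure) +
  fixes e :: "'g \<Rightarrow> bool list" and s w n :: nat
    and Q :: "nat \<Rightarrow> 'g \<Rightarrow> nat \<Rightarrow> bool prog" and \<theta> K \<eta> :: real
  assumes finite_carrier [simp]: "finite (carrier G)"
    and encoding: "binary_encoding G s e"
    and s_pos: "s > 0"
    and fits: "\<And>x g i. x < n \<Longrightarrow> g \<in> carrier G \<Longrightarrow> i < s \<Longrightarrow> fits w (Q x g i)"
    and \<theta>: "0 \<le> \<theta>" "\<theta> \<le> 1"
    and \<eta>: "0 \<le> \<eta>"
    and fee: "1 + 2 ^ w * exp (\<theta> - K) ^ s \<le> exp \<eta> ^ s"
begin

abbreviation \<Omega> :: "('g \<times> nat) set" where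
  "\<Omega> \<equiv> carrier G \<times> {..<s}"

definition potential :: "(nat \<times> 'g \<times> nat) list \<Rightarrow> memory \<Rightarrow> nat set \<Rightarrow> (nat \<Rightarrow> 'g) \<Rightarrow> real" where
  "potential us m \<Delta> a =
     \<theta> * advantage (val (steps_prog Q us) m) (truths G e a us)
     - K * real (transfers (steps_prog Q us) m \<Delta>) - \<eta> * real (cost (steps_prog Q us) m)"

lemma potential_Nil [simp]: "potential [] m \<Delta> a = 0"
  by (simp add: potential_def)

lemma exp_potential_Cons:
  "exp (potential ((x, g, i) # us) m \<Delta> a) =
     gain \<theta> (val (Q x g i) m) (e (range_prod G (a(x := g)) 0 x) ! i) *
     exp (- K * real (transfers (Q x g i) m \<Delta>) - \<eta> * real (cost (Q x g i) m)) *
     exp (potential us (mem (Q x g i) m) (\<Delta> - accessed (Q x g i) m) (a(x := g)))"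
  by (simp add: potential_def gain_def exp_add[symmetric] algebra_simps)

lemma range_prod_closed:
  assumes "\<And>j. a j \<in> carrier G"
  shows "range_prod G a l r \<in> carrier G"
proof -
  have "foldr (\<lambda>j x. a j \<otimes> x) js \<one> \<in> carrier G" for js
    by (induction js) (use assms in auto)
  then show ?thesis by (simp add: range_prod_def)
qed

lemma gain_le: "gain \<theta> y t \<le> exp \<theta> * gain \<theta> y' t"
  using \<theta> by (auto simp: gain_def exp_add[symmetric])

text \<open>
  \<open>S\<close> is the set of candidates compatible with the information received so far.  Revealing the
  prefix product after each query splits \<open>S\<close> further; since the prefix products determine the
  candidate, at most one candidate is left at the end.
\<close>

lemma sum_exp_potential_le:
  assumes "finite S"
    and "\<And>p. p \<in> S \<Longrightarrow> word_memory w (M p)"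
    and "\<And>p j. p \<in> S \<Longrightarrow> A p j \<in> carrier G"
    and "word_memory w b"
    and "set xs \<subseteq> {..<n}"
    and "\<And>zs. zs \<in> lists_of \<Omega> (length xs) \<Longrightarrow> inj_on (\<lambda>p. prefixes G (A p) (zip xs zs)) S"
  shows "(\<Sum>p\<in>S. \<Sum>zs\<in>lists_of \<Omega> (length xs). exp (potential (zip xs zs) (M p) {c. M p c \<noteq> b c} (A p)))
    \<le> (real (card (carrier G)) * (real s * (2 * exp (\<theta>\<^sup>2 / 2)))) ^ length xs * real (card S) powr (1 - 1 / real s)"
  using assms
proof (induction xs arbitrary: S M A b)
  case Nil
  \<comment> \<open>No prefix products remain, so injectivity leaves at most one candidate, and the
    power of \<open>card S\<close> is \<open>card S\<close> itself.\<close>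
  have "inj_on (\<lambda>p. prefixes G (A p) (zip [] [])) S" using Nil.prems(6)[of "[]"] by simp
  then have "card S \<le> card {[] :: 'g list}" by (rule card_inj_on_le) auto
  then have "card S \<le> 1" by simp
  then have "card S = 0 \<or> card S = 1" by linarith
  then show ?case by auto
next
  case (Cons x xs)
  define \<tau> where "\<tau> = real s * (2 * exp (\<theta>\<^sup>2 / 2))"
  define E where "E = 1 - 1 / real s"
  define B where "B = (real (card (carrier G)) * \<tau>) ^ length xs"
  define V where "V g p m \<Delta> = (\<Sum>zs\<in>lists_of \<Omega> (length xs). exp (potential (zip xs zs) m \<Delta> ((A p)(x := g))))"
    for g p m \<Delta>
  define P where "P g p = range_prod G ((A p)(x := g)) 0 x" for g p
  define S' where "S' g a = {p \<in> S. P g p = a}" for g a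
  define f where "f g p i = gain \<theta> (val (Q x g i) (M p)) (e (P g p) ! i) *
      exp (- K * real (transfers (Q x g i) (M p) {c. M p c \<noteq> b c}) - \<eta> * real (cost (Q x g i) (M p))) *
      V g p (mem (Q x g i) (M p)) ({c. M p c \<noteq> b c} - accessed (Q x g i) (M p))" for g p i
  have B0: "B \<ge> 0" by (simp add: B_def \<tau>_def)
  have x: "x < n" using Cons.prems by simp
  have A': "p \<in> S \<Longrightarrow> g \<in> carrier G \<Longrightarrow> ((A p)(x := g)) j \<in> carrier G" for p g j
    using Cons.prems(3) by simp
  \<comment> \<open>Once the prefix product is fixed to \<open>a\<close>, the correct bit is the
    same for all candidates, so the gain depends on the answer alone and can serve as
    \<open>H\<close>.\<close>
  have one: "(\<Sum>p\<in>S' g a. f g p i) \<le> gain \<theta> (val (Q x g i) b) (e a ! i) * B * real (card (S' g a)) powr E"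
    if g: "g \<in> carrier G" and i: "i < s" for g a i
  proof -
    have "(\<Sum>p\<in>S' g a. f g p i) = (\<Sum>p\<in>S' g a. gain \<theta> (val (Q x g i) (M p)) (e a ! i) *
      exp (- K * real (transfers (Q x g i) (M p) {c. M p c \<noteq> b c}) - \<eta> * real (cost (Q x g i) (M p))) *
      V g p (mem (Q x g i) (M p)) ({c. M p c \<noteq> b c} - accessed (Q x g i) (M p)))"
      by (intro sum.cong) (auto simp: f_def S'_def)
    also have "\<dots> \<le> gain \<theta> (val (Q x g i) b) (e a ! i) * B * real (card (S' g a)) powr E"
      unfolding E_def
    proof (rule sum_simulation_le[where w = w and \<theta> = \<theta>])
      fix S'' M' b'
      assume S'': "S'' \<subseteq> S' g a" and M': "\<And>p. p \<in> S'' \<Longrightarrow> word_memory w (M' p)" and b': "word_memory w b'"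
      have sub: "S'' \<subseteq> S" using S'' by (auto simp: S'_def)
      show "(\<Sum>p\<in>S''. V g p (M' p) {c. M' p c \<noteq> b' c}) \<le> B * real (card S'') powr (1 - 1 / real s)"
        unfolding V_def B_def \<tau>_def
      proof (rule Cons.IH)
        show "finite S''" using sub Cons.prems(1) by (rule finite_subset)
        show "set xs \<subseteq> {..<n}" using Cons.prems(5) by simp
        show "((A p)(x := g)) j \<in> carrier G" if "p \<in> S''" for p j using that sub g A' by blast
        fix zs assume zs: "zs \<in> lists_of \<Omega> (length xs)"
        then have "(g, i) # zs \<in> lists_of \<Omega> (length (x # xs))"
          using g i by (auto simp: lists_of_def)
        from Cons.prems(6)[OF this]
        have "inj_on (\<lambda>p. P g p # prefixes G ((A p)(x := g)) (zip xs zs)) S" by (simp add: P_def)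
        then have "inj_on (\<lambda>p. P g p # prefixes G ((A p)(x := g)) (zip xs zs)) S''"
          using sub by (rule inj_on_subset)
        \<comment> \<open>The first prefix product is constant on \<open>S''\<close>, so the later
          ones must separate the candidates.\<close>
        moreover have "P g p = a" if "p \<in> S''" for p using that S'' by (auto simp: S'_def)
        ultimately show "inj_on (\<lambda>p. prefixes G ((A p)(x := g)) (zip xs zs)) S''"
          by (auto simp: inj_on_def)
      qed (use M' b' in auto)
    qed (use Cons.prems s_pos fee \<eta> B0 gain_le fits x g i in
      \<open>auto simp: S'_def V_def intro: sum_nonneg\<close>)
    finally show ?thesis .
  qed
  have "(\<Sum>p\<in>S. \<Sum>zs\<in>lists_of \<Omega> (length (x # xs)). exp (potential (zip (x # xs) zs) (M p) {c. M p c \<noteq> b c} (A p)))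
      = (\<Sum>p\<in>S. \<Sum>g\<in>carrier G. \<Sum>i<s. f g p i)"
    unfolding f_def V_def P_def
    by (simp add: sum_lists_of_Suc sum.cartesian_product' exp_potential_Cons sum_distrib_left split_beta)
  also have "\<dots> = (\<Sum>g\<in>carrier G. \<Sum>p\<in>S. \<Sum>i<s. f g p i)"
    by (rule sum.swap)
  also have "\<dots> = (\<Sum>g\<in>carrier G. \<Sum>a\<in>carrier G. \<Sum>p\<in>S' g a. \<Sum>i<s. f g p i)"
    unfolding S'_def using Cons.prems(1) range_prod_closed A'
    by (intro sum.cong refl sum.group[symmetric]) (auto simp: P_def)
  also have "\<dots> = (\<Sum>g\<in>carrier G. \<Sum>a\<in>carrier G. \<Sum>i<s. \<Sum>p\<in>S' g a. f g p i)"
    by (intro sum.cong refl sum.swap)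
  also have "\<dots> \<le> (\<Sum>g\<in>carrier G. B * (real (card S) powr E * \<tau>))"
  proof (intro sum_mono)
    fix g assume g: "g \<in> carrier G"
    let ?h = "\<lambda>a. \<Sum>i<s. gain \<theta> (val (Q x g i) b) (e a ! i)"
    have "(\<Sum>a\<in>carrier G. \<Sum>i<s. \<Sum>p\<in>S' g a. f g p i)
       \<le> (\<Sum>a\<in>carrier G. \<Sum>i<s. gain \<theta> (val (Q x g i) b) (e a ! i) * B * real (card (S' g a)) powr E)"
      using g by (intro sum_mono one) auto
    also have "\<dots> = B * (\<Sum>a\<in>carrier G. real (card (S' g a)) powr E * ?h a)"
      by (simp add: sum_distrib_left sum_distrib_right mult_ac)
    \<comment> \<open>The sets \<open>S' g a\<close> partition \<open>S\<close>, and the predictions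
      \<open>val (Q x g i) b\<close> do not depend on \<open>a\<close>. Hence the second factor
      compares fixed predictions with the encodings of all group elements.\<close>
    also have "(\<Sum>a\<in>carrier G. real (card (S' g a)) powr E * ?h a)
      \<le> (\<Sum>a\<in>carrier G. real (card (S' g a))) powr E * (\<Sum>a\<in>carrier G. ?h a ^ s) powr (1 / real s)"
      unfolding E_def by (rule Holder_sum) (auto simp: s_pos intro: sum_nonneg)
    also have "(\<Sum>a\<in>carrier G. real (card (S' g a))) = real (card S)"
    proof -
      have "(\<Sum>a\<in>carrier G. \<Sum>p\<in>S' g a. 1) = (\<Sum>p\<in>S. 1 :: real)"
        unfolding S'_def using Cons.prems(1) range_prod_closed A' g
        by (intro sum.group) (auto simp: P_def)
      then show ?thesis by simp
    qed
    also have "(\<Sum>a\<in>carrier G. ?h a ^ s) powr (1 / real s) \<le> (\<tau> ^ s) powr (1 / real s)"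
      unfolding \<tau>_def using encoding \<theta>
      by (intro powr_mono2 sum_encoding_gain_le sum_nonneg zero_le_power) auto
    also have "(\<tau> ^ s) powr (1 / real s) = \<tau>"
      using s_pos by (simp add: \<tau>_def powr_realpow[symmetric] powr_powr)
    finally show "(\<Sum>a\<in>carrier G. \<Sum>i<s. \<Sum>p\<in>S' g a. f g p i) \<le> B * (real (card S) powr E * \<tau>)"
      using B0 by (simp add: mult_left_mono)
  qed
  also have "\<dots> = (real (card (carrier G)) * \<tau>) ^ length (x # xs) * real (card S) powr E"
    by (simp add: B_def)
  finally show ?case by (simp add: \<tau>_def E_def)
qed

end


section \<open>Appending sequences of steps\<close>

lemma val_steps_append [simp]:
  "val (steps_prog Q (us @ vs)) m = val (steps_prog Q us) m @ val (steps_prog Q vs) (mem (steps_prog Q us) m)"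
  by (induction us arbitrary: m) auto

lemma mem_steps_append [simp]:
  "mem (steps_prog Q (us @ vs)) m = mem (steps_prog Q vs) (mem (steps_prog Q us) m)"
  by (induction us arbitrary: m) auto

lemma cost_steps_append [simp]:
  "cost (steps_prog Q (us @ vs)) m = cost (steps_prog Q us) m + cost (steps_prog Q vs) (mem (steps_prog Q us) m)"
  by (induction us arbitrary: m) auto

lemma transfers_steps_append [simp]:
  "transfers (steps_prog Q (us @ vs)) m \<Delta> = transfers (steps_prog Q us) m \<Delta>
     + transfers (steps_prog Q vs) (mem (steps_prog Q us) m) (\<Delta> - accessed (steps_prog Q us) m)"
  by (induction us arbitrary: m \<Delta>) (auto simp: Diff_eq Int_assoc)

lemma length_val_steps [simp]: "length (val (steps_prog Q us) m) = length us"
  by (induction us arbitrary: m) auto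

lemma truths_append [simp]:
  "truths G e a (us @ vs) = truths G e a us @ truths G e (store a us) vs"
  by (induction G e a us rule: truths.induct) (auto simp: fun_upd_def)

lemma length_truths [simp]: "length (truths G e a us) = length us"
  by (induction G e a us rule: truths.induct) (auto simp: fun_upd_def)

lemma store_outside: "j \<notin> fst ` set us \<Longrightarrow> store a us j = a j"
  by (induction a us rule: store.induct) auto

lemma store_zip_nth:
  "length ls = length us \<Longrightarrow> distinct ls \<Longrightarrow> i < length ls \<Longrightarrow> store a (zip ls us) (ls ! i) = fst (us ! i)"
proof (induction ls us arbitrary: a i rule: list_induct2)
  case (Cons x xs u us)
  obtain g k where u: "u = (g, k)" by fastforce
  have "x \<notin> fst ` set (zip xs us)" using Cons.prems by (auto dest: set_zip_leftD)
  then show ?case using Cons by (cases i) (auto simp: u store_outside)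
qed simp

lemma store_closed:
  "(\<And>j. a j \<in> carrier G) \<Longrightarrow> set us \<subseteq> carrier G \<times> B \<Longrightarrow> store a (zip ls us) j \<in> carrier G"
proof (induction ls arbitrary: us a)
  case (Cons x ls)
  show ?case
  proof (cases us)
    case (Cons u us')
    then show ?thesis using Cons.prems by (cases u) (auto intro!: Cons.IH)
  qed (use Cons.prems in simp)
qed simp


section \<open>One node of the tree\<close>

text \<open>
  If two candidates for the first half differ, then the least position at which they do is the only
  one within some prefix queried in the second half.
\<close>

definition interleaved :: "nat list \<Rightarrow> nat list \<Rightarrow> bool" where
  "interleaved ls rs \<longleftrightarrow> distinct ls \<and> set ls \<inter> set rs = {} \<and>
     (\<forall>x\<in>set ls. \<exists>z\<in>set rs. x \<le> z \<and> {x<..z} \<inter> set ls = {})"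

context simulation
begin

text \<open>The two products share all factors except the one at \<open>x\<close>; the factors
  before it cancel on the left and those after it on the right.\<close>

lemma range_prod_cancel:
  assumes A: "\<And>j. A j \<in> carrier G" and A': "\<And>j. A' j \<in> carrier G"
    and xz: "x \<le> z" and agree: "\<And>j. j \<le> z \<Longrightarrow> j \<noteq> x \<Longrightarrow> A j = A' j"
    and eq: "range_prod G A 0 z = range_prod G A' 0 z"
  shows "A x = A' x"
proof -
  let ?f = "\<lambda>A j y. A j \<otimes> y"
  have closed: "foldr (?f B) js \<one> \<in> carrier G" if "\<And>j. B j \<in> carrier G" for js and B :: "nat \<Rightarrow> 'g"
    by (induction js) (use that in auto)
  have left: "y = y'"
    if "foldr (?f A) js y = foldr (?f A) js y'" "y \<in> carrier G" "y' \<in> carrier G" for js y y'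
  proof -
    have cl: "foldr (?f A) js y \<in> carrier G" if "y \<in> carrier G" for js y
      by (induction js) (use A that in auto)
    show ?thesis using that
      by (induction js) (auto simp: A cl)
  qed
  have split: "[0..<Suc z] = [0..<x] @ x # [Suc x..<Suc z]"
    using xz by (metis le_add_diff_inverse less_Suc_eq_le upt_add_eq_append upt_conv_Cons zero_le le_imp_less_Suc le_SucI)
  have same: "foldr (?f A') js y = foldr (?f A) js y" if "\<forall>j\<in>set js. j \<le> z \<and> j \<noteq> x" for js y
    using that agree by (induction js) auto
  have tl: "foldr (?f A') [Suc x..<Suc z] \<one> = foldr (?f A) [Suc x..<Suc z] \<one>"
    by (rule same) (simp only: set_upt, auto)
  have hd: "foldr (?f A') [0..<x] y = foldr (?f A) [0..<x] y" for y
    by (rule same) (simp only: set_upt, use xz in auto)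
  let ?t = "foldr (?f A) [Suc x..<Suc z] \<one>"
  have "foldr (?f A) [0..<x] (A x \<otimes> ?t) = foldr (?f A) [0..<x] (A' x \<otimes> ?t)"
    using eq unfolding range_prod_def split by (simp add: tl hd del: upt_Suc)
  then have "A x \<otimes> ?t = A' x \<otimes> ?t"
    by (rule left) (use A A' closed[of A] in auto)
  then show ?thesis using A A' closed[of A] by simp
qed

text \<open>\<open>B\<close> and \<open>B'\<close> are the stores at the moment when
  \<open>z\<close> is queried: the same updates at positions of \<open>rs\<close> have been applied
  to \<open>A\<close> and \<open>A'\<close>. How many depends on where \<open>z\<close> stands in
  \<open>rs\<close>, hence the existential form.\<close>

lemma prefixes_eqD:
  assumes "prefixes G A (zip rs zs) = prefixes G A' (zip rs zs)"
    and "z \<in> set rs" and "length rs = length zs" and "set zs \<subseteq> \<Omega>"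
    and "\<And>j. A j \<in> carrier G" and "\<And>j. A' j \<in> carrier G"
  shows "\<exists>B B'. (\<forall>j. B j \<in> carrier G \<and> B' j \<in> carrier G) \<and> range_prod G B 0 z = range_prod G B' 0 z \<and>
    (\<forall>j. j \<notin> set rs \<longrightarrow> B j = A j \<and> B' j = A' j) \<and> (\<forall>j. A j = A' j \<longrightarrow> B j = B' j)"
  using assms(3,1,2,4-)
proof (induction rs zs arbitrary: A A' rule: list_induct2)
  case (Cons x rs u zs)
  obtain g i where u: "u = (g, i)" by fastforce
  with Cons.prems have g: "g \<in> carrier G" by auto
  have eqs: "range_prod G (A(x := g)) 0 x = range_prod G (A'(x := g)) 0 x"
    "prefixes G (A(x := g)) (zip rs zs) = prefixes G (A'(x := g)) (zip rs zs)"
    using Cons.prems(1) by (simp_all add: u)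
  show ?case
  proof (cases "z = x")
    case True
    show ?thesis
      by (rule exI[of _ "A(x := g)"], rule exI[of _ "A'(x := g)"]) (use True eqs(1) g Cons.prems(4,5) in \<open>auto simp: fun_upd_def\<close>)
  next
    case False
    then have z: "z \<in> set rs" using Cons.prems by auto
    have "\<exists>B B'. (\<forall>j. B j \<in> carrier G \<and> B' j \<in> carrier G) \<and> range_prod G B 0 z = range_prod G B' 0 z \<and>
      (\<forall>j. j \<notin> set rs \<longrightarrow> B j = (A(x := g)) j \<and> B' j = (A'(x := g)) j) \<and>
      (\<forall>j. (A(x := g)) j = (A'(x := g)) j \<longrightarrow> B j = B' j)"
      by (rule Cons.IH[OF eqs(2) z]) (use g Cons.prems in auto)
    then obtain B B' where "\<forall>j. B j \<in> carrier G \<and> B' j \<in> carrier G"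
      "range_prod G B 0 z = range_prod G B' 0 z"
      "\<forall>j. j \<notin> set rs \<longrightarrow> B j = (A(x := g)) j \<and> B' j = (A'(x := g)) j"
      "\<forall>j. (A(x := g)) j = (A'(x := g)) j \<longrightarrow> B j = B' j" by blast
    note BB = this
    show ?thesis
      by (rule exI[of _ B], rule exI[of _ B']) (use BB in \<open>auto split: if_splits\<close>)
  qed
qed simp

lemma prefixes_determine:
  assumes eq: "prefixes G A (zip rs zs) = prefixes G A' (zip rs zs)"
    and zs: "zs \<in> lists_of \<Omega> (length rs)" and ls: "interleaved ls rs"
    and A: "\<And>j. A j \<in> carrier G" and A': "\<And>j. A' j \<in> carrier G"
    and agree: "\<And>j. j \<notin> set ls \<Longrightarrow> A j = A' j"
  shows "A = A'"
proof (rule ccontr)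
  assume "A \<noteq> A'"
  then obtain x0 where x0: "A x0 \<noteq> A' x0" by auto
  define x where "x = (LEAST j. A j \<noteq> A' j)"
  have x: "A x \<noteq> A' x" unfolding x_def using x0 by (rule LeastI)
  have below: "A j = A' j" if "j < x" for j using that not_less_Least unfolding x_def by blast
  have "x \<in> set ls" using x agree by blast
  then obtain z where z: "z \<in> set rs" "x \<le> z" "{x<..z} \<inter> set ls = {}" and xrs: "x \<notin> set rs"
    using ls unfolding interleaved_def by blast
  obtain B B' where B: "\<And>j. B j \<in> carrier G" "\<And>j. B' j \<in> carrier G"
      "range_prod G B 0 z = range_prod G B' 0 z"
      "\<And>j. j \<notin> set rs \<Longrightarrow> B j = A j \<and> B' j = A' j" "\<And>j. A j = A' j \<Longrightarrow> B j = B' j"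
    using prefixes_eqD[OF eq z(1) _ _ A A'] zs unfolding lists_of_def by (metis (mono_tags, lifting) mem_Collect_eq)
  have "B x = B' x"
  proof (rule range_prod_cancel[OF B(1,2) z(2) _ B(3)])
    fix j assume j: "j \<le> z" "j \<noteq> x"
    have "A j = A' j"
    proof (cases "j < x")
      case False
      then have "j \<in> {x<..z}" using j by auto
      then show ?thesis using z(3) agree by blast
    qed (rule below)
    then show "B j = B' j" by (rule B(5))
  qed
  \<comment> \<open>\<open>ls\<close> and \<open>rs\<close> are disjoint, so no update of the second
    half has overwritten position \<open>x\<close>.\<close>
  then show False using B(4)[OF xrs] x by simp
qed

text \<open>The factor by which a step of a second half can raise the mean moment. For a nearly
  optimal encoding the denominator is close to 2, which leaves about
  \<open>exp (\<theta>\<^sup>2 / 2)\<close>.\<close>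

definition rate :: real where
  "rate = 2 * exp (\<theta>\<^sup>2 / 2) / real (card (carrier G)) powr (1 / real s)"

lemma rate_nonneg: "rate \<ge> 0"
  by (simp add: rate_def)

lemma card_carrier_pos: "card (carrier G) > 0"
  using one_closed by (auto simp: card_gt_0_iff)

lemma fits_steps:
  "set us \<subseteq> \<Omega> \<Longrightarrow> set xs \<subseteq> {..<n} \<Longrightarrow> fits w (steps_prog Q (zip xs us))"
proof (induction xs arbitrary: us)
  case (Cons x xs)
  show ?case
  proof (cases us)
    case (Cons u us')
    then show ?thesis using Cons.prems
      by (cases u) (auto intro!: fits_bind_prog fits Cons.IH)
  qed simp
qed simp

text \<open>The candidates are the contents of the first half, about which the simulated memory
  \<open>m\<close> knows nothing. The exponent \<open>1 - 1 / s\<close> on their number saves a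
  factor \<open>N powr (1 / s)\<close> per step, the denominator of \<open>rate\<close>.\<close>

lemma sum_node_le:
  assumes ls: "interleaved ls rs" and len: "length ls = k" "length rs = k"
    and n: "set ls \<subseteq> {..<n}" "set rs \<subseteq> {..<n}"
    and m: "word_memory w m" and a: "\<And>j. a j \<in> carrier G"
  defines "M us \<equiv> mem (steps_prog Q (zip ls us)) m"
  shows "(\<Sum>us\<in>lists_of \<Omega> k. \<Sum>vs\<in>lists_of \<Omega> k.
      exp (potential (zip rs vs) (M us) {c. M us c \<noteq> m c} (store a (zip ls us))))
    \<le> real (card \<Omega>) ^ (2 * k) * rate ^ k"
proof -
  define N where "N = real (card (carrier G))"
  define F where "F us = (\<Sum>vs\<in>lists_of \<Omega> k.
      exp (potential (zip rs vs) (M us) {c. M us c \<noteq> m c} (store a (zip ls us))))" for us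
  \<comment> \<open>The query indices of the first half leave no trace in the store, so prefix
    products can separate only candidates that have the same indices.\<close>
  define S where "S js = {us \<in> lists_of \<Omega> k. map snd us = js}" for js :: "nat list"
  define E where "E = 1 - 1 / real s"
  have N: "N > 0" using card_carrier_pos by (simp add: N_def)
  have E: "E \<ge> 0" using s_pos by (simp add: E_def)
  have finS: "finite (S js)" for js by (simp add: S_def finite_lists_of)
  have part: "(\<Sum>us\<in>S js. F us) \<le> (N * (real s * (2 * exp (\<theta>\<^sup>2 / 2)))) ^ k * (N ^ k) powr E" for js
  proof -
    have "(\<Sum>us\<in>S js. F us) \<le> (N * (real s * (2 * exp (\<theta>\<^sup>2 / 2)))) ^ k * real (card (S js)) powr E"
      unfolding F_def N_def E_def len(2)[symmetric]
    proof (rule sum_exp_potential_le)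
      fix us assume us: "us \<in> S js"
      then have us': "set us \<subseteq> \<Omega>" by (auto simp: S_def lists_of_def)
      show "word_memory w (M us)"
        unfolding M_def by (intro word_memory_mem fits_steps us' n m)
      show "store a (zip ls us) j \<in> carrier G" for j
        using us' by (intro store_closed[of a G us "{..<s}"] a) auto
    next
      fix zs assume zs: "zs \<in> lists_of \<Omega> (length rs)"
      show "inj_on (\<lambda>us. prefixes G (store a (zip ls us)) (zip rs zs)) (S js)"
      proof (rule inj_onI)
        fix us us' assume us: "us \<in> S js" "us' \<in> S js"
          and eq: "prefixes G (store a (zip ls us)) (zip rs zs) = prefixes G (store a (zip ls us')) (zip rs zs)"
        have sub: "set us \<subseteq> \<Omega>" "set us' \<subseteq> \<Omega>" "length us = k" "length us' = k" "map snd us = map snd us'"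
          using us by (auto simp: S_def lists_of_def)
        have "store a (zip ls us) = store a (zip ls us')"
        proof (rule prefixes_determine[OF eq zs ls])
          show "store a (zip ls us) j \<in> carrier G" for j
            using sub by (intro store_closed[of a G us "{..<s}"] a) auto
          show "store a (zip ls us') j \<in> carrier G" for j
            using sub by (intro store_closed[of a G us' "{..<s}"] a) auto
          show "store a (zip ls us) j = store a (zip ls us') j" if "j \<notin> set ls" for j
          proof -
            have "j \<notin> fst ` set (zip ls us)" "j \<notin> fst ` set (zip ls us')"
              using that by (auto dest: set_zip_leftD)
            then show ?thesis by (simp add: store_outside)
          qed
        qed
        then have "fst (us ! i) = fst (us' ! i)" if "i < k" for i
          using store_zip_nth[of ls us i a] store_zip_nth[of ls us' i a] ls that len sub
          by (auto simp: interleaved_def)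
        then have "map fst us = map fst us'"
          using sub by (auto intro: nth_equalityI)
        then show "us = us'" using sub(5) by (metis zip_map_fst_snd)
      qed
    qed (use finS m n in auto)
    also have "real (card (S js)) powr E \<le> (N ^ k) powr E"
    proof (intro powr_mono2)
      have "card (S js) \<le> card (lists_of (carrier G) k)"
      proof (rule card_inj_on_le)
        show "inj_on (map fst) (S js)"
          by (rule inj_onI) (auto simp: S_def, metis zip_map_fst_snd)
        show "map fst ` S js \<subseteq> lists_of (carrier G) k"
          by (fastforce simp: S_def lists_of_def)
      qed (simp add: finite_lists_of)
      then show "real (card (S js)) \<le> N ^ k"
        by (simp add: card_lists_of N_def flip: of_nat_power)
    qed (use E in auto)
    finally show ?thesis using N by (simp add: mult_left_mono)
  qed
  have "(\<Sum>us\<in>lists_of \<Omega> k. F us) = (\<Sum>js\<in>lists_of {..<s} k. \<Sum>us\<in>S js. F us)"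
    unfolding S_def
  proof (intro sum.group[symmetric])
    show "map snd ` lists_of \<Omega> k \<subseteq> lists_of {..<s} k"
      by (fastforce simp: lists_of_def)
  qed (simp_all add: finite_lists_of)
  also have "\<dots> \<le> (\<Sum>js\<in>lists_of {..<s} k. (N * (real s * (2 * exp (\<theta>\<^sup>2 / 2)))) ^ k * (N ^ k) powr E)"
    by (intro sum_mono part)
  also have "\<dots> = (real s) ^ k * (N * (real s * (2 * exp (\<theta>\<^sup>2 / 2)))) ^ k * (N ^ k) powr E"
    by (simp add: card_lists_of)
  also have "(N ^ k) powr E = (N / N powr (1 / real s)) ^ k"
  proof -
    have "(N ^ k) powr E = (N powr E) ^ k"
      using N by (simp add: powr_realpow[symmetric] powr_powr mult.commute)
    also have "N powr E = N / N powr (1 / real s)"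
      using N by (simp add: E_def powr_diff)
    finally show ?thesis .
  qed
  also have "real s ^ k * (N * (real s * (2 * exp (\<theta>\<^sup>2 / 2)))) ^ k * (N / N powr (1 / real s)) ^ k
      = ((N * real s) ^ 2 * rate) ^ k"
    unfolding rate_def N_def[symmetric] power_mult_distrib[symmetric]
    by (rule arg_cong[of _ _ "\<lambda>x. x ^ k"]) (simp add: power2_eq_square mult_ac)
  also have "\<dots> = real (card \<Omega>) ^ (2 * k) * rate ^ k"
    by (simp add: power_mult_distrib power_mult N_def)
  finally show ?thesis by (simp add: F_def)
qed

end


section \<open>The tree of time intervals\<close>

text \<open>The bit-reversal permutation of \<open>{..<2 ^ h}\<close>, scaled by \<open>D\<close> and shifted by \<open>c\<close>.\<close>

primrec schedule :: "nat \<Rightarrow> nat \<Rightarrow> nat \<Rightarrow> nat list" where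
  "schedule D c 0 = [c]"
| "schedule D c (Suc h) = schedule (2 * D) c h @ schedule (2 * D) (D + c) h"

lemma length_schedule [simp]: "length (schedule D c h) = 2 ^ h"
  by (induction h arbitrary: D c) auto

lemma set_schedule: "set (schedule D c h) = (\<lambda>j. c + D * j) ` {..<2 ^ h}"
proof (induction h arbitrary: D c)
  case (Suc h)
  have "(\<lambda>j. c + D * j) ` {..<2 ^ Suc h}
      = (\<lambda>j. c + D * (2 * j)) ` {..<2 ^ h} \<union> (\<lambda>j. c + D * Suc (2 * j)) ` {..<2 ^ h}"
  proof -
    have "{..<2 ^ Suc h} = (\<lambda>j. 2 * j) ` {..<2 ^ h} \<union> (\<lambda>j. Suc (2 * j)) ` {..<(2::nat) ^ h}"
    proof (intro equalityI subsetI)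
      fix j :: nat assume "j \<in> {..<2 ^ Suc h}"
      then have j: "j div 2 < 2 ^ h" by (simp add: less_mult_imp_div_less mult.commute)
      show "j \<in> (\<lambda>j. 2 * j) ` {..<2 ^ h} \<union> (\<lambda>j. Suc (2 * j)) ` {..<(2::nat) ^ h}"
      proof (cases "even j")
        case True
        then have "j = 2 * (j div 2)" by simp
        then show ?thesis using j by blast
      next
        case False
        then have "j = Suc (2 * (j div 2))" by simp
        then show ?thesis using j by blast
      qed
    qed auto
    then show ?thesis by (simp add: image_Un image_image)
  qed
  then show ?case by (simp add: Suc.IH algebra_simps)
qed auto

lemma distinct_schedule: "D > 0 \<Longrightarrow> distinct (schedule D c h)"
proof -
  assume "D > 0"
  then have "card (set (schedule D c h)) = 2 ^ h"
    unfolding set_schedule by (subst card_image) (auto simp: inj_on_def)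
  then show ?thesis by (intro card_distinct) simp
qed

text \<open>The left half visits \<open>c\<close> plus even multiples of \<open>D\<close>, the right
  half \<open>c\<close> plus odd ones. So each left position is followed by a right one before the
  next left position.\<close>

lemma interleaved_schedule:
  assumes "D > 0"
  shows "interleaved (schedule (2 * D) c h) (schedule (2 * D) (D + c) h)"
proof -
  have apart: "c + 2 * D * j \<noteq> D + c + 2 * D * j'" for j j'
  proof
    assume "c + 2 * D * j = D + c + 2 * D * j'"
    then have "D * (2 * j) = D * Suc (2 * j')" by (simp add: algebra_simps)
    then have "2 * j = Suc (2 * j')" using assms by (simp only: mult_left_cancel)
    then show False by presburger
  qed
  have gap: "{c + 2 * D * j<..D + c + 2 * D * j} \<inter> set (schedule (2 * D) c h) = {}" for j
  proof -
    have "\<not> (c + 2 * D * j < c + 2 * D * j' \<and> c + 2 * D * j' \<le> D + c + 2 * D * j)" for j'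
    proof
      assume *: "c + 2 * D * j < c + 2 * D * j' \<and> c + 2 * D * j' \<le> D + c + 2 * D * j"
      then have "Suc j \<le> j'" using assms by simp
      then have "2 * D * Suc j \<le> 2 * D * j'" by (rule mult_le_mono2)
      then show False using * assms by simp
    qed
    then show ?thesis by (auto simp: set_schedule)
  qed
  show ?thesis
    unfolding interleaved_def
  proof (intro conjI ballI)
    show "set (schedule (2 * D) c h) \<inter> set (schedule (2 * D) (D + c) h) = {}"
      using apart by (auto simp: set_schedule)
    fix x assume "x \<in> set (schedule (2 * D) c h)"
    then obtain j where j: "x = c + 2 * D * j" "j < 2 ^ h" by (auto simp: set_schedule)
    show "\<exists>z\<in>set (schedule (2 * D) (D + c) h). x \<le> z \<and> {x<..z} \<inter> set (schedule (2 * D) c h) = {}"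
      using gap[of j] j by (intro bexI[of _ "D + c + 2 * D * j"]) (auto simp: set_schedule)
  qed (use assms distinct_schedule in auto)
qed

text \<open>A leaf is counted as often as its index has binary digits \<open>1\<close>.\<close>

primrec tree_sum :: "nat \<Rightarrow> real list \<Rightarrow> real" where
  "tree_sum 0 ws = 0"
| "tree_sum (Suc h) ws =
     sum_list (drop (2 ^ h) ws) + tree_sum h (take (2 ^ h) ws) + tree_sum h (drop (2 ^ h) ws)"

text \<open>Almost all indices have about \<open>h / 2\<close> digits \<open>1\<close>; the shift \<open>r\<close> serves the induction.\<close>

lemma tree_sum_ge_aux:
  assumes "c > 0" "length ws = 2 ^ h" "\<And>x. x \<in> set ws \<Longrightarrow> \<bar>x\<bar> \<le> 1 / 2"
  shows "2 * tree_sum h ws + (r - real h) * sum_list ws \<ge> - (2 ^ h / 4) * (c + (real h + r\<^sup>2) / c)"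
  using assms(2,3)
proof (induction h arbitrary: ws r)
  case 0
  then obtain x where ws: "ws = [x]" by (auto simp: length_Suc_conv)
  have "- (r * x) \<le> \<bar>r\<bar> * \<bar>x\<bar>" by (metis abs_ge_minus_self abs_mult)
  also have "\<dots> \<le> \<bar>r\<bar> * (1 / 2)" using 0 ws by (intro mult_left_mono) auto
  also have "\<dots> \<le> (c + r\<^sup>2 / c) / 4"
  proof -
    have "0 \<le> (c - \<bar>r\<bar>)\<^sup>2" by simp
    then have "2 * \<bar>r\<bar> * c \<le> (c + r\<^sup>2 / c) * c" using assms(1) by (simp add: power2_eq_square algebra_simps)
    then show ?thesis using assms(1) by simp
  qed
  finally have "- ((c + r\<^sup>2 / c) / 4) \<le> r * x" by linarith
  then show ?case by (simp add: ws)
next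
  case (Suc h)
  define us vs where "us = take (2 ^ h) ws" and "vs = drop (2 ^ h) ws"
  have len: "length us = 2 ^ h" "length vs = 2 ^ h" using Suc.prems by (auto simp: us_def vs_def)
  have mem: "x \<in> set ws" if "x \<in> set us \<or> x \<in> set vs" for x
    using that by (auto simp: us_def vs_def dest: in_set_takeD in_set_dropD)
  \<comment> \<open>A leaf of the right half has one more digit 1, so \<open>r\<close> becomes
    \<open>r - 1\<close> on the left and \<open>r + 1\<close> on the right. The mean of their
    squares is \<open>r\<^sup>2 + 1\<close>, which turns \<open>h\<close> into
    \<open>Suc h\<close>.\<close>
  have u: "2 * tree_sum h us + ((r - 1) - real h) * sum_list us \<ge> - (2 ^ h / 4) * (c + (real h + (r - 1)\<^sup>2) / c)"
    using len mem Suc.prems by (intro Suc.IH) auto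
  have v: "2 * tree_sum h vs + ((r + 1) - real h) * sum_list vs \<ge> - (2 ^ h / 4) * (c + (real h + (r + 1)\<^sup>2) / c)"
    using len mem Suc.prems by (intro Suc.IH) auto
  have "sum_list ws = sum_list us + sum_list vs"
    by (metis append_take_drop_id sum_list_append us_def vs_def)
  then have "2 * tree_sum (Suc h) ws + (r - real (Suc h)) * sum_list ws
      = (2 * tree_sum h us + ((r - 1) - real h) * sum_list us) + (2 * tree_sum h vs + ((r + 1) - real h) * sum_list vs)"
    by (simp add: us_def[symmetric] vs_def[symmetric] algebra_simps)
  moreover have "- (2 ^ h / 4) * (c + (real h + (r - 1)\<^sup>2) / c) + - (2 ^ h / 4) * (c + (real h + (r + 1)\<^sup>2) / c)
      = - (2 ^ Suc h / 4) * (c + (real (Suc h) + r\<^sup>2) / c)"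
    using assms(1) by (simp add: field_simps power2_eq_square)
  ultimately show ?case using u v by linarith
qed

lemma tree_sum_ge:
  assumes "h > 0" "length ws = 2 ^ h" "\<And>x. x \<in> set ws \<Longrightarrow> \<bar>x\<bar> \<le> 1 / 2"
  shows "2 * tree_sum h ws \<ge> real h * sum_list ws - 2 ^ h / 2 * sqrt (real h)"
proof -
  \<comment> \<open>The choice \<open>c = sqrt h\<close> balances the error terms \<open>c\<close>
    and \<open>h / c\<close>.\<close>
  have "2 * tree_sum h ws + (0 - real h) * sum_list ws
      \<ge> - (2 ^ h / 4) * (sqrt (real h) + (real h + 0\<^sup>2) / sqrt (real h))"
    using assms by (intro tree_sum_ge_aux) auto
  moreover have "real h / sqrt (real h) = sqrt (real h)" by (simp add: real_div_sqrt)
  ultimately show ?thesis by (simp add: algebra_simps)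
qed

definition scores :: "bool list \<Rightarrow> bool list \<Rightarrow> real list" where
  "scores ys ts = map (\<lambda>(y, t). if y = t then 1 / 2 else - 1 / 2) (zip ys ts)"

lemma advantage_scores: "advantage ys ts = sum_list (scores ys ts)"
  by (simp add: advantage_def scores_def)

lemma abs_scores: "x \<in> set (scores ys ts) \<Longrightarrow> \<bar>x\<bar> \<le> 1 / 2"
  by (auto simp: scores_def split: if_splits)

lemma scores_append:
  "length ys = length ts \<Longrightarrow> scores (ys @ ys') (ts @ ts') = scores ys ts @ scores ys' ts'"
  by (simp add: scores_def)

section \<open>Moments of a whole level and the average over levels\<close>

context simulation
begin

text \<open>
  The sum of the potentials of the nodes at depth \<open>d\<close>; the second half of a node is simulated from
  the memory at the beginning of its first half.
\<close>

fun level :: "nat \<Rightarrow> nat \<Rightarrow> (nat \<times> 'g \<times> nat) list \<Rightarrow> memory \<Rightarrow> (nat \<Rightarrow> 'g) \<Rightarrow> real" where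
  "level 0 d us m a = 0"
| "level (Suc h) 0 us m a =
     (let m' = mem (steps_prog Q (take (2 ^ h) us)) m
      in potential (drop (2 ^ h) us) m' {c. m' c \<noteq> m c} (store a (take (2 ^ h) us)))"
| "level (Suc h) (Suc d) us m a =
     level h d (take (2 ^ h) us) m a +
     level h d (drop (2 ^ h) us) (mem (steps_prog Q (take (2 ^ h) us)) m) (store a (take (2 ^ h) us))"

text \<open>At every depth the right halves contain \<open>2 ^ (h - 1)\<close> steps in total, so
  all levels have the same bound. It is uniform in the initial memory and store, so the sum over the
  later nodes factors out.\<close>

lemma sum_exp_level_le:
  assumes "d < h" "D > 0" "set (schedule D c h) \<subseteq> {..<n}" "word_memory w m" "\<And>j. a j \<in> carrier G"
  shows "(\<Sum>us\<in>lists_of \<Omega> (2 ^ h). exp (level h d (zip (schedule D c h) us) m a))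
    \<le> real (card \<Omega>) ^ (2 ^ h) * rate ^ (2 ^ (h - 1))"
  using assms
proof (induction h arbitrary: d D c m a)
  case (Suc h)
  define ls rs where "ls = schedule (2 * D) c h" and "rs = schedule (2 * D) (D + c) h"
  have len: "length ls = 2 ^ h" "length rs = 2 ^ h" by (simp_all add: ls_def rs_def)
  have sub: "set ls \<subseteq> {..<n}" "set rs \<subseteq> {..<n}" using Suc.prems(3) by (auto simp: ls_def rs_def)
  have split: "(\<Sum>us\<in>lists_of \<Omega> (2 ^ Suc h). exp (level (Suc h) d (zip (schedule D c (Suc h)) us) m a))
     = (\<Sum>us\<in>lists_of \<Omega> (2 ^ h). \<Sum>vs\<in>lists_of \<Omega> (2 ^ h). exp (level (Suc h) d (zip ls us @ zip rs vs) m a))"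
    unfolding power_Suc mult_2 sum_lists_of_add
    by (intro sum.cong refl) (auto simp: lists_of_def zip_append ls_def rs_def)
  show ?case
  proof (cases d)
    case 0
    have "(\<Sum>us\<in>lists_of \<Omega> (2 ^ h). \<Sum>vs\<in>lists_of \<Omega> (2 ^ h). exp (level (Suc h) d (zip ls us @ zip rs vs) m a))
      = (\<Sum>us\<in>lists_of \<Omega> (2 ^ h). \<Sum>vs\<in>lists_of \<Omega> (2 ^ h). exp (potential (zip rs vs)
          (mem (steps_prog Q (zip ls us)) m) {c. mem (steps_prog Q (zip ls us)) m c \<noteq> m c} (store a (zip ls us))))"
      by (intro sum.cong refl) (auto simp: 0 lists_of_def len Let_def)
    also have "\<dots> \<le> real (card \<Omega>) ^ (2 * 2 ^ h) * rate ^ (2 ^ h)"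
      using interleaved_schedule[OF Suc.prems(2), of c h] Suc.prems
      by (intro sum_node_le len sub) (auto simp: ls_def rs_def)
    finally show ?thesis unfolding split by simp
  next
    case (Suc d')
    define R where "R = real (card \<Omega>) ^ (2 ^ h) * rate ^ (2 ^ (h - 1))"
    have R: "R \<ge> 0" using rate_nonneg by (simp add: R_def)
    have d': "d' < h" using Suc Suc.prems by simp
    have "(\<Sum>us\<in>lists_of \<Omega> (2 ^ h). \<Sum>vs\<in>lists_of \<Omega> (2 ^ h). exp (level (Suc h) d (zip ls us @ zip rs vs) m a))
      = (\<Sum>us\<in>lists_of \<Omega> (2 ^ h). exp (level h d' (zip ls us) m a) * (\<Sum>vs\<in>lists_of \<Omega> (2 ^ h).
          exp (level h d' (zip rs vs) (mem (steps_prog Q (zip ls us)) m) (store a (zip ls us)))))"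
      unfolding sum_distrib_left
      by (intro sum.cong refl) (auto simp: Suc lists_of_def len exp_add)
    also have "\<dots> \<le> (\<Sum>us\<in>lists_of \<Omega> (2 ^ h). exp (level h d' (zip ls us) m a) * R)"
    proof (intro sum_mono mult_left_mono)
      fix us assume "us \<in> lists_of \<Omega> (2 ^ h)"
      then have us: "set us \<subseteq> \<Omega>" by (simp add: lists_of_def)
      show "(\<Sum>vs\<in>lists_of \<Omega> (2 ^ h).
          exp (level h d' (zip rs vs) (mem (steps_prog Q (zip ls us)) m) (store a (zip ls us)))) \<le> R"
        unfolding R_def rs_def
      proof (rule Suc.IH[OF d'])
        show "word_memory w (mem (steps_prog Q (zip ls us)) m)"
          by (intro word_memory_mem fits_steps us sub Suc.prems)
        show "store a (zip ls us) j \<in> carrier G" for j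
          using us by (intro store_closed[of a G us "{..<s}"] Suc.prems) auto
      qed (use Suc.prems sub in \<open>auto simp: rs_def\<close>)
    qed auto
    also have "\<dots> \<le> R * R"
      unfolding sum_distrib_right[symmetric] unfolding R_def ls_def using Suc.prems sub R
      by (intro mult_right_mono Suc.IH d') (auto simp: ls_def R_def)
    also have "R * R = real (card \<Omega>) ^ (2 ^ Suc h) * rate ^ (2 ^ (Suc h - 1))"
    proof -
      have "(2::nat) ^ (h - 1) + 2 ^ (h - 1) = 2 ^ h" using d' by (cases h) auto
      then have "rate ^ (2 ^ (h - 1)) * rate ^ (2 ^ (h - 1)) = rate ^ (2 ^ h)"
        by (simp flip: power_add)
      then show ?thesis by (simp add: R_def mult_2 power_add mult_ac)
    qed
    finally show ?thesis unfolding split .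
  qed
qed simp

text \<open>
  Every probe is a transfer for at most one node.  In the induction, \<open>\<Delta>\<close> contains the cells whose
  first access is a transfer for an ancestor; it loses every cell accessed in the first half, hence
  every cell changed there, which is where the second half has its own transfers.
\<close>

lemma sum_level_ge:
  assumes "length us = 2 ^ h" "K \<ge> 0"
  shows "(\<Sum>d<h. level h d us m a) \<ge>
      \<theta> * tree_sum h (scores (val (steps_prog Q us) m) (truths G e a us))
      - K * (real (cost (steps_prog Q us) m) - real (transfers (steps_prog Q us) m \<Delta>))
      - real h * \<eta> * real (cost (steps_prog Q us) m)"
  using assms(1)
proof (induction h arbitrary: us m a \<Delta>)
  case 0
  show ?case using assms(2) transfers_le_cost[of "steps_prog Q us" m \<Delta>] by simp
next
  case (Suc h)
  define ls rs where "ls = take (2 ^ h) us" and "rs = drop (2 ^ h) us"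
  define m' where "m' = mem (steps_prog Q ls) m"
  define \<Delta>' where "\<Delta>' = \<Delta> - accessed (steps_prog Q ls) m"
  define A where "A = {c. m' c \<noteq> m c}"
  have us: "us = ls @ rs" by (simp add: ls_def rs_def)
  have len: "length ls = 2 ^ h" "length rs = 2 ^ h" using Suc.prems by (auto simp: ls_def rs_def)
  have "A \<inter> \<Delta>' = {}"
    using mem_not_accessed unfolding A_def \<Delta>'_def m'_def by blast
  then have tr: "transfers (steps_prog Q rs) m' (A \<union> \<Delta>') =
      transfers (steps_prog Q rs) m' A + transfers (steps_prog Q rs) m' \<Delta>'"
    by (rule transfers_Un)
  note l = Suc.IH[OF len(1), where m = m and a = a and \<Delta> = \<Delta>]
  \<comment> \<open>For the second half, the present node joins the ancestors: its own transfers
    concern \<open>A\<close>, theirs the remaining cells \<open>\<Delta>'\<close>.\<close>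
  note r = Suc.IH[OF len(2), where m = m' and a = "store a ls" and \<Delta> = "A \<union> \<Delta>'"]
  have lev: "(\<Sum>d<Suc h. level (Suc h) d us m a) = potential rs m' A (store a ls)
      + (\<Sum>d<h. level h d ls m a) + (\<Sum>d<h. level h d rs m' (store a ls))"
    by (simp add: sum.lessThan_Suc_shift ls_def[symmetric] rs_def[symmetric] m'_def[symmetric] A_def
        Let_def sum.distrib del: sum.lessThan_Suc)
  have ts: "tree_sum (Suc h) (scores (val (steps_prog Q us) m) (truths G e a us))
      = advantage (val (steps_prog Q rs) m') (truths G e (store a ls) rs)
      + tree_sum h (scores (val (steps_prog Q ls) m) (truths G e a ls))
      + tree_sum h (scores (val (steps_prog Q rs) m') (truths G e (store a ls) rs))"
    using len by (simp add: us scores_append advantage_scores m'_def) (simp add: scores_def)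
  have co: "real (cost (steps_prog Q us) m) = real (cost (steps_prog Q ls) m) + real (cost (steps_prog Q rs) m')"
    by (simp add: us m'_def)
  have tu: "real (transfers (steps_prog Q us) m \<Delta>) = real (transfers (steps_prog Q ls) m \<Delta>) + real (transfers (steps_prog Q rs) m' \<Delta>')"
    by (simp add: us m'_def \<Delta>'_def)
  \<comment> \<open>At this node only the second half pays \<open>\<eta>\<close> per probe, whereas
    the claimed bound charges both halves.\<close>
  have "\<eta> * real (cost (steps_prog Q ls) m) \<ge> 0" using \<eta> by simp
  then show ?case
    using l r unfolding lev ts co tu tr potential_def
    by (simp add: algebra_simps)
qed

text \<open>By the tangent to \<open>exp\<close> at \<open>x\<close>, an average level of at least
  \<open>x\<close> makes the average of the exponentials at least \<open>exp x\<close>. Markov's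
  inequality is then applied to that average.\<close>

lemma card_level_sum_ge_le:
  assumes "h > 0" "set (schedule 1 0 h) \<subseteq> {..<n}" "word_memory w m" "\<And>j. a j \<in> carrier G"
  shows "real (card {us \<in> lists_of \<Omega> (2 ^ h). (\<Sum>d<h. level h d (zip (schedule 1 0 h) us) m a) \<ge> real h * x})
    \<le> real (card \<Omega>) ^ (2 ^ h) * (rate ^ (2 ^ (h - 1)) * exp (- x))"
proof -
  define L where "L d us = level h d (zip (schedule 1 0 h) us) m a" for d us
  define T where "T = {us \<in> lists_of \<Omega> (2 ^ h). (\<Sum>d<h. L d us) \<ge> real h * x}"
  have fin: "finite (lists_of \<Omega> (2 ^ h))" by (simp add: finite_lists_of)
  have "real h * exp x \<le> (\<Sum>d<h. exp (L d us))" if "us \<in> T" for us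
  proof -
    have "0 \<le> exp x * ((\<Sum>d<h. L d us) - real h * x)" using that by (simp add: T_def)
    also have "\<dots> + real h * exp x = (\<Sum>d<h. exp x * (1 + (L d us - x)))"
      by (simp add: sum_distrib_left[symmetric] sum.distrib sum_subtractf algebra_simps)
    also have "\<dots> \<le> (\<Sum>d<h. exp x * exp (L d us - x))"
      by (intro sum_mono mult_left_mono exp_ge_add_one_self) auto
    finally show ?thesis by (simp add: exp_diff)
  qed
  then have "(\<Sum>us\<in>T. real h * exp x) \<le> (\<Sum>us\<in>T. \<Sum>d<h. exp (L d us))"
    by (rule sum_mono)
  also have "\<dots> \<le> (\<Sum>us\<in>lists_of \<Omega> (2 ^ h). \<Sum>d<h. exp (L d us))"
    using fin by (intro sum_mono2 sum_nonneg) (auto simp: T_def)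
  also have "\<dots> = (\<Sum>d<h. \<Sum>us\<in>lists_of \<Omega> (2 ^ h). exp (L d us))"
    by (rule sum.swap)
  also have "\<dots> \<le> (\<Sum>d<h. real (card \<Omega>) ^ (2 ^ h) * rate ^ (2 ^ (h - 1)))"
    unfolding L_def using assms by (intro sum_mono sum_exp_level_le) auto
  finally have "real h * (real (card T) * exp x) \<le> real h * (real (card \<Omega>) ^ (2 ^ h) * rate ^ (2 ^ (h - 1)))"
    by (simp add: mult_ac)
  then have "real (card T) * exp x \<le> real (card \<Omega>) ^ (2 ^ h) * rate ^ (2 ^ (h - 1))"
    using assms(1) by simp
  then have "real (card T) * exp x * exp (- x) \<le> real (card \<Omega>) ^ (2 ^ h) * rate ^ (2 ^ (h - 1)) * exp (- x)"
    by (intro mult_right_mono) auto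
  then show ?thesis by (simp add: T_def L_def mult.assoc flip: exp_add)
qed

end


section \<open>The hard distribution\<close>

text \<open>Each step takes two operations, hence one less than the logarithm. For
  \<open>n \<ge> 2\<close>, fewer than half of the \<open>n\<close> operations are left for
  padding.\<close>

definition height :: "nat \<Rightarrow> nat" where
  "height n = nat \<lfloor>log 2 (real n)\<rfloor> - 1"

lemma height_bounds:
  assumes "n \<ge> 2"
  shows "2 * 2 ^ height n \<le> n" "n < 4 * 2 ^ height n"
proof -
  obtain k where k: "2 ^ k \<le> n" "n < 2 ^ (k + 1)"
    using ex_power_ivl1[of 2 n] assms by auto
  have "\<lfloor>log 2 (real n)\<rfloor> = int k"
    using floor_log_nat_eq_if[of 2 k n] k by simp
  moreover have "k \<noteq> 0" using k assms by (cases k) auto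
  ultimately have "k = Suc (height n)" by (simp add: height_def)
  then show "2 * 2 ^ height n \<le> n" "n < 4 * 2 ^ height n" using k by auto
qed

primrec step_ops :: "(nat \<times> 'g \<times> nat) list \<Rightarrow> 'g operation list" where
  "step_ops [] = []"
| "step_ops (u # us) = (case u of (x, g, i) \<Rightarrow> [Update x g, Query 0 x i]) @ step_ops us"

text \<open>The padding consists of updates, which add no queries and can only increase the running
  time.\<close>

definition hard_ops :: "nat \<Rightarrow> 'g monoid \<Rightarrow> ('g \<times> nat) list \<Rightarrow> 'g operation list" where
  "hard_ops n G zs = step_ops (zip (schedule 1 0 (height n)) zs)
     @ replicate (n - 2 * 2 ^ height n) (Update 0 \<one>\<^bsub>G\<^esub>)"

definition hard_inputs :: "nat \<Rightarrow> 'g monoid \<Rightarrow> nat \<Rightarrow> ('g \<times> nat) list set" where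
  "hard_inputs n G s = lists_of (carrier G \<times> {..<s}) (2 ^ height n)"

text \<open>The first case only serves to stay within the valid sequences.\<close>

definition hard_pmf :: "nat \<Rightarrow> 'g monoid \<Rightarrow> nat \<Rightarrow> 'g operation list pmf" where
  "hard_pmf n G s =
     (if s = 0 \<or> n < 2 then return_pmf (replicate n (Update 0 \<one>\<^bsub>G\<^esub>))
      else map_pmf (hard_ops n G) (pmf_of_set (hard_inputs n G s)))"

lemma length_step_ops [simp]: "length (step_ops us) = 2 * length us"
  by (induction us) auto

lemma finite_hard_inputs: "finite (carrier G) \<Longrightarrow> finite (hard_inputs n G s)"
  by (simp add: hard_inputs_def finite_lists_of)

lemma card_hard_inputs:
  "finite (carrier G) \<Longrightarrow> card (hard_inputs n G s) = (card (carrier G \<times> {..<s})) ^ (2 ^ height n)"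
  by (simp add: hard_inputs_def card_lists_of)

lemma hard_inputs_nonempty:
  assumes "group G" "finite (carrier G)" "s > 0"
  shows "hard_inputs n G s \<noteq> {}"
proof -
  have "\<one>\<^bsub>G\<^esub> \<in> carrier G" using assms(1) by (simp add: group.is_monoid monoid.one_closed)
  then have "card (carrier G \<times> {..<s}) > 0" using assms by (auto simp: card_gt_0_iff)
  then have "card (hard_inputs n G s) > 0" using assms by (simp add: card_hard_inputs)
  then show ?thesis by auto
qed

lemma step_ops_valid:
  assumes "set xs \<subseteq> {..<n}" "set zs \<subseteq> carrier G \<times> {..<s}" "x \<in> set (step_ops (zip xs zs))"
  shows "valid_op G n s x"
  using assms
proof (induction xs arbitrary: zs)
  case (Cons y ys)
  then show ?case by (cases zs) auto
qed simp

lemma set_schedule_height: "n \<ge> 2 \<Longrightarrow> set (schedule 1 0 (height n)) \<subseteq> {..<n}"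
  using height_bounds[of n] by (auto simp: set_schedule)

lemma hard_ops_valid:
  assumes "group G" "n \<ge> 2" "zs \<in> hard_inputs n G s"
  shows "hard_ops n G zs \<in> op_sequences G n s"
proof -
  have one: "\<one>\<^bsub>G\<^esub> \<in> carrier G" using assms(1) by (simp add: group.is_monoid monoid.one_closed)
  have zs: "set zs \<subseteq> carrier G \<times> {..<s}" "length zs = 2 ^ height n"
    using assms(3) by (auto simp: hard_inputs_def lists_of_def)
  have "length (hard_ops n G zs) = n"
    using height_bounds[OF assms(2)] zs by (simp add: hard_ops_def)
  moreover have "valid_op G n s x" if "x \<in> set (hard_ops n G zs)" for x
    using that step_ops_valid[OF set_schedule_height[OF assms(2)] zs(1)] one assms(2)
    by (auto simp: hard_ops_def)
  ultimately show ?thesis by (simp add: op_sequences_def)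
qed

lemma set_hard_pmf:
  assumes "group G" "finite (carrier G)" "n \<ge> 1"
  shows "set_pmf (hard_pmf n G s) \<subseteq> op_sequences G n s"
proof (cases "s = 0 \<or> n < 2")
  case True
  have "\<one>\<^bsub>G\<^esub> \<in> carrier G" using assms(1) by (simp add: group.is_monoid monoid.one_closed)
  then show ?thesis using True assms(3) by (auto simp: hard_pmf_def op_sequences_def)
next
  case False
  then show ?thesis using assms hard_inputs_nonempty[OF assms(1,2), of s n] hard_ops_valid[OF assms(1)]
    by (auto simp: hard_pmf_def finite_hard_inputs)
qed

section \<open>Runs on the hard inputs\<close>

definition step_prog :: "'g data_structure \<Rightarrow> nat \<Rightarrow> 'g \<Rightarrow> nat \<Rightarrow> bool prog" where
  "step_prog D x g i = bind_prog (ds_update D x g) (\<lambda>_. ds_query D 0 x i)"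

lemma run_updates: "fst (run_from D m (replicate k (Update x g))) = []"
  by (induction k arbitrary: m) (auto simp: split_beta Let_def)

lemma run_steps:
  "fst (run_from D m (step_ops us @ replicate k (Update x g))) = val (steps_prog (step_prog D) us) m \<and>
   cost (steps_prog (step_prog D) us) m \<le> snd (run_from D m (step_ops us @ replicate k (Update x g)))"
proof (induction us arbitrary: m)
  case Nil
  show ?case by (simp add: run_updates)
next
  case (Cons u us)
  obtain y g i where u: "u = (y, g, i)" by (metis prod_cases3)
  show ?case
    using Cons.IH[of "mem (ds_query D 0 y i) (mem (ds_update D y g) m)"]
    by (simp add: u exec_eq split_beta Let_def step_prog_def)
qed

lemma correct_answers_steps:
  "correct_answers G e a (step_ops us @ replicate k (Update x g)) = truths G e a us"
proof (induction us arbitrary: a)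
  case Nil
  have "correct_answers G e a (replicate k (Update x g)) = []" by (induction k arbitrary: a) auto
  then show ?case by simp
next
  case (Cons u us)
  then show ?case by (cases u) (simp add: fun_upd_def)
qed

lemma num_queries_steps: "num_queries (step_ops us @ replicate k (Update x g)) = length us"
  by (induction us) (auto simp: num_queries_def)

lemma advantage_eq:
  "length ys = length ts \<Longrightarrow>
     advantage ys ts = real (length (filter (\<lambda>(x, y). x = y) (zip ys ts))) - real (length ys) / 2"
  by (induction ys ts rule: list_induct2) (auto simp: field_simps)

lemma succeeds_hard_opsD:
  assumes "succeeds G e n \<epsilon> \<delta> D (hard_ops n G zs)" "length zs = 2 ^ height n"
  defines "us \<equiv> zip (schedule 1 0 (height n)) zs"
  shows "advantage (val (steps_prog (step_prog D) us) (ds_init D)) (truths G e (\<lambda>_. \<one>\<^bsub>G\<^esub>) us) \<ge> \<delta> * 2 ^ height n"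
    and "real (cost (steps_prog (step_prog D) us) (ds_init D)) \<le> \<epsilon> * real n * log 2 (real n)"
proof -
  let ?k = "n - 2 * 2 ^ height n"
  have ops: "hard_ops n G zs = step_ops us @ replicate ?k (Update 0 \<one>\<^bsub>G\<^esub>)"
    by (simp add: hard_ops_def us_def)
  have len: "length us = 2 ^ height n" using assms(2) by (simp add: us_def)
  note r = run_steps[of D "ds_init D" us ?k 0 "\<one>\<^bsub>G\<^esub>"]
  have "real (num_correct G e D (hard_ops n G zs)) \<ge> (1 / 2 + \<delta>) * real (length us)"
    using assms(1) by (simp add: succeeds_def ops num_queries_steps)
  moreover have "real (num_correct G e D (hard_ops n G zs)) =
      advantage (val (steps_prog (step_prog D) us) (ds_init D)) (truths G e (\<lambda>_. \<one>\<^bsub>G\<^esub>) us) + real (length us) / 2"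
    using r by (simp add: num_correct_def answers_def run_def ops correct_answers_steps advantage_eq)
  ultimately show "advantage (val (steps_prog (step_prog D) us) (ds_init D)) (truths G e (\<lambda>_. \<one>\<^bsub>G\<^esub>) us) \<ge> \<delta> * 2 ^ height n"
    by (simp add: len algebra_simps)
  have "cost (steps_prog (step_prog D) us) (ds_init D) \<le> running_time D (hard_ops n G zs)"
    using r by (simp add: running_time_def run_def ops)
  then show "real (cost (steps_prog (step_prog D) us) (ds_init D)) \<le> \<epsilon> * real n * log 2 (real n)"
    using assms(1) unfolding succeeds_def by linarith
qed

section \<open>The tail bound for a deterministic data structure\<close>

lemma advantage_le: "advantage ys ts \<le> real (min (length ys) (length ts)) / 2"
proof (induction ys arbitrary: ts)
  case Nil
  then show ?case by (simp add: advantage_def)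
next
  case (Cons y ys)
  show ?case
  proof (cases ts)
    case Nil
    then show ?thesis by (simp add: advantage_def)
  next
    case (Cons t ts')
    then show ?thesis using Cons.IH[of ts'] by simp
  qed
qed

lemma card_le_of_encoding:
  assumes "binary_encoding G s e" "finite (carrier G)"
  shows "card (carrier G) \<le> 2 ^ s"
proof -
  have "card (carrier G) \<le> card (lists_of (UNIV :: bool set) s)"
    using assms by (intro card_inj_on_le[of e] finite_lists_of) (auto simp: binary_encoding_def lists_of_def)
  then show ?thesis by (simp add: card_lists_of)
qed

text \<open>The bound on \<open>s\<close> gives
  \<open>log 2 N / s \<ge> 1 / (1 + \<epsilon>) \<ge> 1 - \<epsilon>\<close>, so the denominator of
  \<open>rate\<close> is at least \<open>2 powr (1 - \<epsilon>)\<close>.\<close>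

lemma (in simulation) rate_le:
  assumes "\<epsilon> \<ge> 0" "real s \<le> (1 + \<epsilon>) * log 2 (real (card (carrier G)))"
  shows "rate \<le> exp (\<epsilon> + \<theta>\<^sup>2 / 2)"
proof -
  define N where "N = real (card (carrier G))"
  have N: "N > 0" using card_carrier_pos by (simp add: N_def)
  have "1 - \<epsilon> \<le> 1 / (1 + \<epsilon>)"
    using assms(1) by (simp add: le_divide_eq algebra_simps)
  also have "\<dots> \<le> log 2 N / real s"
    using assms s_pos by (simp add: N_def field_simps)
  finally have "2 powr (1 - \<epsilon>) \<le> 2 powr (log 2 N / real s)" by simp
  also have "\<dots> = N powr (1 / real s)"
    using N powr_powr[of 2 "log 2 N" "1 / real s"] by simp
  finally have lower: "2 powr (1 - \<epsilon>) \<le> N powr (1 / real s)" .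
  have "rate \<le> 2 * exp (\<theta>\<^sup>2 / 2) / 2 powr (1 - \<epsilon>)"
    unfolding rate_def N_def[symmetric] using lower N by (intro divide_left_mono) auto
  also have "\<dots> = 2 powr \<epsilon> * exp (\<theta>\<^sup>2 / 2)"
    by (simp add: powr_diff)
  also have "2 powr \<epsilon> \<le> exp \<epsilon>"
    using assms(1) ln_2_less_1 mult_left_le[of "ln 2" \<epsilon>] by (simp add: powr_def)
  finally show ?thesis by (simp add: exp_add mult_right_mono)
qed

text \<open>A success forces the levels to sum to at least \<open>h * x\<close>, and
  \<open>card_level_sum_ge_le\<close> shows that few inputs allow this. The rest balances the
  constants.\<close>

lemma card_successes_le:
  fixes G :: "'g monoid" and w\<^sub>1 g\<^sub>1 \<gamma> \<epsilon> \<delta> C :: real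
  assumes pos: "w\<^sub>1 > 0" "g\<^sub>1 > 0" "\<gamma> > 0"
    and n: "n \<ge> 16"
    and G: "group G" "finite (carrier G)" "binary_encoding G s e"
    and w: "w\<^sub>1 * log 2 (real n) \<le> real w"
    and g: "g\<^sub>1 * real w \<le> log 2 (real (card (carrier G)))"
    and s: "real s \<le> (1 + \<epsilon>) * log 2 (real (card (carrier G)))"
    and \<epsilon>: "\<epsilon> \<ge> \<gamma> / log 2 (real n)" and \<delta>: "\<delta> > 0" "\<delta>\<^sup>2 \<ge> C * \<epsilon>"
    and C: "C \<ge> 2 / \<gamma>" "C \<ge> 32 * (1 / 2 + 8 * (1 + 1 / g\<^sub>1) + 4 / (g\<^sub>1 * w\<^sub>1))"
    and D: "data_structure_for G n s w D"
  shows "real (card {zs \<in> hard_inputs n G s. succeeds G e n \<epsilon> \<delta> D (hard_ops n G zs)})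
    \<le> real (card (hard_inputs n G s)) * exp (- \<delta>\<^sup>2 * real n / 128)"
proof (cases "\<delta> \<le> 1 / 2")
  case False
  \<comment> \<open>Success with \<open>\<delta> > 1 / 2\<close> would need more correct answers
    than there are queries.\<close>
  have "\<not> succeeds G e n \<epsilon> \<delta> D (hard_ops n G zs)" if "zs \<in> hard_inputs n G s" for zs
  proof
    assume succ: "succeeds G e n \<epsilon> \<delta> D (hard_ops n G zs)"
    have len: "length zs = 2 ^ height n" using that by (simp add: hard_inputs_def lists_of_def)
    have "\<delta> * 2 ^ height n \<le> 2 ^ height n / 2"
      using order_trans[OF succeeds_hard_opsD(1)[OF succ len] advantage_le] len by simp
    then show False using False by simp
  qed
  then have none: "{zs \<in> hard_inputs n G s. succeeds G e n \<epsilon> \<delta> D (hard_ops n G zs)} = {}" by blast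
  show ?thesis unfolding none by simp
next
  case True
  define h where "h = height n"
  \<comment> \<open>This maximises \<open>\<theta> * \<delta> / 4 - \<theta>\<^sup>2 / 4\<close>:
    the advantage per level against the second-order loss in the rate, both per step.\<close>
  define \<theta> where "\<theta> = \<delta> / 2"
  \<comment> \<open>The summand 1 covers \<open>\<theta>\<close>, and \<open>1 / g\<^sub>1\<close>
    pays for a word of \<open>w\<close> bits because \<open>s \<ge> g\<^sub>1 * w\<close>.\<close>
  define K where "K = 1 + 1 / g\<^sub>1"
  \<comment> \<open>Then \<open>exp \<eta> ^ s = exp 1\<close>, which is at least the 2 to which
    \<open>1 + 2 ^ w * exp (\<theta> - K) ^ s\<close> is bounded.\<close>
  define \<eta> where "\<eta> = 1 / real s"
  define N where "N = (2::real) ^ h"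
  have hb: "2 * 2 ^ h \<le> n" "n < 4 * 2 ^ h" using height_bounds[of n] n by (auto simp: h_def)
  then have hN: "2 * N \<le> real n" "real n < 4 * N"
    unfolding N_def by (metis of_nat_le_iff of_nat_mult of_nat_numeral of_nat_power, metis of_nat_less_iff of_nat_mult of_nat_numeral of_nat_power)
  have N: "N > 0" by (simp add: N_def)
  \<comment> \<open>With \<open>n \<ge> 16\<close> the height, which exceeds
    \<open>log 2 n - 2\<close>, is at least half of the logarithm.\<close>
  have log4: "log 2 (real n) \<ge> 4"
    using n by (simp add: le_log_iff)
  have "log 2 (real n) < real h + 2"
    using hN n by (simp add: log_less_iff powr_add powr_realpow N_def)
  then have h_log: "log 2 (real n) \<le> 2 * real h" and h: "h > 0" using log4 by linarith+
  have w_pos: "real w > 0" using w pos log4 by (smt (verit) mult_pos_pos)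
  have s_log: "log 2 (real (card (carrier G))) \<le> real s"
  proof -
    have "card (carrier G) > 0" using G monoid.one_closed[OF group.is_monoid[OF G(1)]]
      by (auto simp: card_gt_0_iff)
    moreover have "real (card (carrier G)) \<le> 2 ^ s"
      using card_le_of_encoding[OF G(3,2)] by (metis of_nat_le_iff of_nat_numeral of_nat_power)
    ultimately show ?thesis by (simp add: log_le_iff powr_realpow)
  qed
  have sw: "g\<^sub>1 * real w \<le> real s" using g s_log by linarith
  then have s_pos: "s > 0" using w_pos pos by (metis gr0I mult_pos_pos of_nat_0 not_le)
  have \<epsilon>_pos: "\<epsilon> > 0" using \<epsilon> pos log4 by (smt (verit) divide_pos_pos)
  have \<theta>: "0 \<le> \<theta>" "\<theta> \<le> 1" using \<delta> True by (auto simp: \<theta>_def)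
  have K: "K \<ge> 0" using pos by (simp add: K_def)
  interpret simulation G e s w n "step_prog D" \<theta> K \<eta>
  proof -
    interpret group G by fact
    show "simulation G e s w n (step_prog D) \<theta> K \<eta>"
    proof unfold_locales
      show "finite (carrier G)" "binary_encoding G s e" "0 < s" "0 \<le> \<theta>" "\<theta> \<le> 1" "0 \<le> \<eta>"
        using G s_pos \<theta> by (auto simp: \<eta>_def)
      show "fits w (step_prog D x g i)" if "x < n" "g \<in> carrier G" "i < s" for x g i
        using D that unfolding step_prog_def data_structure_for_def
        by (intro fits_bind_prog) auto
      have "real s * (\<theta> - K) \<le> real s * (- (1 / g\<^sub>1))"
        using \<theta> by (intro mult_left_mono) (auto simp: K_def)
      also have "\<dots> \<le> - real w" using sw pos by (simp add: field_simps)
      finally have le: "real s * (\<theta> - K) \<le> - real w" .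
      have "(2::real) ^ w \<le> exp 1 ^ w" using exp_ge_add_one_self[of 1] by (intro power_mono) auto
      then have "2 ^ w * exp (\<theta> - K) ^ s \<le> exp (real w) * exp (real s * (\<theta> - K))"
        by (simp add: exp_of_nat_mult[symmetric] mult_right_mono)
      also have "\<dots> \<le> 1" using le by (simp flip: exp_add)
      finally show "1 + 2 ^ w * exp (\<theta> - K) ^ s \<le> exp \<eta> ^ s"
        using exp_ge_add_one_self[of 1] s_pos by (simp add: \<eta>_def exp_of_nat_mult[symmetric])
    qed
  qed
  \<comment> \<open>The guaranteed average level of a successful run: \<open>\<theta>\<close> times
    an advantage of \<open>\<delta> * N / 4\<close>, minus the transfer fees for all probes spread
    over \<open>h\<close> levels, minus the probe fees.\<close>
  define x where "x = N * (\<delta>\<^sup>2 / 8 - \<epsilon> * (8 * K + 4 / (g\<^sub>1 * w\<^sub>1)))"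
  let ?us = "\<lambda>zs. zip (schedule 1 0 h) zs"
  let ?m = "ds_init D"
  let ?a = "\<lambda>_ :: nat. \<one>\<^bsub>G\<^esub>"
  \<comment> \<open>Here \<open>C \<ge> 2 / \<gamma>\<close> enters: the deviation
    \<open>sqrt h\<close> of the digit count then costs at most half of the advantage.\<close>
  have \<delta>h: "1 \<le> \<delta>\<^sup>2 * real h"
  proof -
    have "2 / \<gamma> * (\<gamma> / log 2 (real n)) \<le> C * \<epsilon>"
      using C(1) \<epsilon> pos log4 order_trans[of 0 "2 / \<gamma>" C] by (intro mult_mono) auto
    then have "2 / log 2 (real n) \<le> \<delta>\<^sup>2" using \<delta>(2) pos by simp
    then have "2 \<le> \<delta>\<^sup>2 * log 2 (real n)" using log4 by (simp add: divide_le_eq)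
    also have "\<dots> \<le> \<delta>\<^sup>2 * (2 * real h)" using h_log by (intro mult_left_mono) auto
    finally show ?thesis by simp
  qed
  have sqrt_h: "sqrt (real h) \<le> \<delta> * real h"
  proof (rule real_le_lsqrt)
    have "real h * 1 \<le> real h * (\<delta>\<^sup>2 * real h)" using \<delta>h by (intro mult_left_mono) auto
    then show "real h \<le> (\<delta> * real h)\<^sup>2" by (simp add: power2_eq_square mult_ac)
  qed (use \<delta> in auto)
  have level_sum: "(\<Sum>d<h. level h d (?us zs) ?m ?a) \<ge> real h * x"
    if zs: "zs \<in> hard_inputs n G s" and succ: "succeeds G e n \<epsilon> \<delta> D (hard_ops n G zs)" for zs
  proof -
    define c where "c = real (cost (steps_prog (step_prog D) (?us zs)) ?m)"
    define ws where "ws = scores (val (steps_prog (step_prog D) (?us zs)) ?m) (truths G e ?a (?us zs))"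
    have len: "length zs = 2 ^ h" using zs by (simp add: hard_inputs_def lists_of_def h_def)
    have adv: "sum_list ws \<ge> \<delta> * N"
      using succeeds_hard_opsD(1)[OF succ] len by (simp add: ws_def advantage_scores N_def h_def)
    have c: "c \<le> \<epsilon> * real n * log 2 (real n)"
      using succeeds_hard_opsD(2)[OF succ] len by (simp add: c_def h_def)
    have "2 * tree_sum h ws \<ge> real h * sum_list ws - N / 2 * sqrt (real h)"
      unfolding N_def using len by (intro tree_sum_ge h) (auto simp: ws_def scores_def abs_scores dest: abs_scores[unfolded scores_def])
    moreover have "real h * sum_list ws \<ge> real h * (\<delta> * N)"
      using adv by (intro mult_left_mono) auto
    moreover have "N / 2 * sqrt (real h) \<le> N / 2 * (\<delta> * real h)"
      using sqrt_h N by (intro mult_left_mono) auto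
    moreover have "real h * (\<delta> * N) - N / 2 * (\<delta> * real h) = 2 * (real h * \<delta> * N / 4)"
      by simp
    ultimately have "tree_sum h ws \<ge> real h * \<delta> * N / 4" by linarith
    then have "\<theta> * tree_sum h ws \<ge> \<theta> * (real h * \<delta> * N / 4)"
      using \<theta> by (intro mult_left_mono) auto
    moreover have "K * c \<le> K * (\<epsilon> * (4 * N) * (2 * real h))"
      using c hN h_log K \<epsilon>_pos log4 n
      by (intro mult_left_mono order_trans[OF c] mult_mono) auto
    moreover have "real h * \<eta> * c \<le> real h * (4 * N * \<epsilon> / (g\<^sub>1 * w\<^sub>1))"
    proof -
      have "g\<^sub>1 * (w\<^sub>1 * log 2 (real n)) \<le> g\<^sub>1 * real w" using w pos by (intro mult_left_mono) auto
      then have "g\<^sub>1 * w\<^sub>1 * log 2 (real n) \<le> real s" using sw by (simp add: mult.assoc)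
      then have \<eta>_log: "\<eta> * log 2 (real n) \<le> 1 / (g\<^sub>1 * w\<^sub>1)"
        using pos s_pos by (simp add: \<eta>_def field_simps)
      have "\<eta> * c \<le> \<eta> * (\<epsilon> * real n * log 2 (real n))"
        using c by (intro mult_left_mono) (auto simp: \<eta>_def)
      also have "\<dots> = (\<epsilon> * real n) * (\<eta> * log 2 (real n))" by simp
      also have "\<dots> \<le> (\<epsilon> * (4 * N)) * (1 / (g\<^sub>1 * w\<^sub>1))"
        using \<eta>_log \<epsilon>_pos hN N log4 by (intro mult_mono) (auto simp: \<eta>_def)
      finally have "real h * (\<eta> * c) \<le> real h * (\<epsilon> * (4 * N) * (1 / (g\<^sub>1 * w\<^sub>1)))"
        by (rule mult_left_mono) simp
      then show ?thesis by (simp add: mult_ac)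
    qed
    \<comment> \<open>The root has no ancestors, hence \<open>{}\<close>.\<close>
    moreover have "(\<Sum>d<h. level h d (?us zs) ?m ?a) \<ge>
      \<theta> * tree_sum h ws - K * (c - real (transfers (steps_prog (step_prog D) (?us zs)) ?m {})) - real h * \<eta> * c"
      unfolding ws_def c_def using len K by (intro sum_level_ge) auto
    moreover have "K * (c - real (transfers (steps_prog (step_prog D) (?us zs)) ?m {})) \<le> K * c"
      using K by (intro mult_left_mono) auto
    moreover have "real h * x = \<theta> * (real h * \<delta> * N / 4) - K * (\<epsilon> * (4 * N) * (2 * real h))
        - real h * (4 * N * \<epsilon> / (g\<^sub>1 * w\<^sub>1))"
      by (simp add: x_def \<theta>_def algebra_simps power2_eq_square)
    ultimately show ?thesis by linarith
  qed
  have fin: "finite (hard_inputs n G s)" by (simp add: finite_hard_inputs)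
  have "{zs \<in> hard_inputs n G s. succeeds G e n \<epsilon> \<delta> D (hard_ops n G zs)}
      \<subseteq> {us \<in> lists_of \<Omega> (2 ^ h). (\<Sum>d<h. level h d (?us us) ?m ?a) \<ge> real h * x}" (is "?A \<subseteq> ?B")
    using level_sum by (auto simp: hard_inputs_def h_def)
  then have "real (card ?A) \<le> real (card ?B)"
    using fin by (intro of_nat_mono card_mono) (auto simp: hard_inputs_def h_def)
  also have "\<dots> \<le> real (card \<Omega>) ^ (2 ^ h) * (rate ^ (2 ^ (h - 1)) * exp (- x))"
    using set_schedule_height[of n] n D h
    by (intro card_level_sum_ge_le) (auto simp: h_def data_structure_for_def word_memory_def)
  also have "\<dots> \<le> real (card \<Omega>) ^ (2 ^ h) * exp (- \<delta>\<^sup>2 * real n / 128)"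
  proof (intro mult_left_mono)
    have "rate ^ (2 ^ (h - 1)) \<le> exp (\<epsilon> + \<theta>\<^sup>2 / 2) ^ (2 ^ (h - 1))"
      using rate_le s \<epsilon>_pos rate_nonneg by (intro power_mono) auto
    also have "\<dots> = exp (N / 2 * (\<epsilon> + \<theta>\<^sup>2 / 2))"
      using h by (cases h) (simp_all add: exp_of_nat_mult[symmetric] N_def)
    finally have "rate ^ (2 ^ (h - 1)) * exp (- x) \<le> exp (N / 2 * (\<epsilon> + \<theta>\<^sup>2 / 2)) * exp (- x)"
      by (intro mult_right_mono) auto
    \<comment> \<open>The rate takes \<open>\<theta>\<^sup>2 / 4 = \<delta>\<^sup>2 / 16\<close> per
      step, half of the \<open>\<delta>\<^sup>2 / 8\<close> in \<open>x\<close>. The factor 32 in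
      \<open>C\<close> lets the terms with \<open>\<epsilon>\<close> take at most half of what
      remains.\<close>
    also have "\<dots> = exp (N * (\<epsilon> * (1 / 2 + 8 * K + 4 / (g\<^sub>1 * w\<^sub>1)) - \<delta>\<^sup>2 / 16))"
      unfolding exp_add[symmetric]
      by (rule arg_cong[of _ _ exp]) (simp add: x_def \<theta>_def power2_eq_square algebra_simps)
    also have "\<dots> \<le> exp (- \<delta>\<^sup>2 * real n / 128)"
    proof -
      have rearrange: "t * z - y / 16 \<le> - (y / 32)" if "32 * z * t \<le> y" for t y z :: real
        using that by (simp add: mult.commute)
      have "32 * (1 / 2 + 8 * K + 4 / (g\<^sub>1 * w\<^sub>1)) * \<epsilon> \<le> C * \<epsilon>"
        using C(2) \<epsilon>_pos by (intro mult_right_mono) (auto simp: K_def)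
      then have "\<epsilon> * (1 / 2 + 8 * K + 4 / (g\<^sub>1 * w\<^sub>1)) - \<delta>\<^sup>2 / 16 \<le> - (\<delta>\<^sup>2 / 32)"
        using rearrange order_trans[OF _ \<delta>(2)] by blast
      then have "N * (\<epsilon> * (1 / 2 + 8 * K + 4 / (g\<^sub>1 * w\<^sub>1)) - \<delta>\<^sup>2 / 16) \<le> N * (- (\<delta>\<^sup>2 / 32))"
        using N by (intro mult_left_mono) auto
      also have "\<dots> \<le> - \<delta>\<^sup>2 * real n / 128"
        using mult_left_mono[of "real n" "4 * N" "\<delta>\<^sup>2"] hN by (simp add: mult_ac)
      finally show ?thesis by simp
    qed
    finally show "rate ^ (2 ^ (h - 1)) * exp (- x) \<le> exp (- \<delta>\<^sup>2 * real n / 128)" .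
  qed auto
  finally show ?thesis by (simp add: card_hard_inputs h_def)
qed


section \<open>Randomized data structures\<close>

text \<open>Sum and expectation are exchanged: for fixed \<open>x\<close> the indicators count the
  \<open>z\<close> with \<open>P z x\<close>, so a bound for each deterministic structure carries
  over to random ones.\<close>

lemma (in prob_space) sum_prob_le_of_card_le:
  assumes "finite Z" "\<And>z. z \<in> Z \<Longrightarrow> {x \<in> space M. P z x} \<in> events"
    and "\<And>x. x \<in> space M \<Longrightarrow> real (card {z \<in> Z. P z x}) \<le> B"
  shows "(\<Sum>z\<in>Z. prob {x \<in> space M. P z x}) \<le> B"
proof -
  have "(\<Sum>z\<in>Z. prob {x \<in> space M. P z x}) = (\<Sum>z\<in>Z. \<integral>x. indicator {x \<in> space M. P z x} x \<partial>M)"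
    using assms(2) by (intro sum.cong refl) simp
  also have "\<dots> = (\<integral>x. (\<Sum>z\<in>Z. indicator {x \<in> space M. P z x} x) \<partial>M)"
    using assms(2) by (intro Bochner_Integration.integral_sum[symmetric]) (auto simp: emeasure_eq_measure)
  also have "\<dots> \<le> (\<integral>x. B \<partial>M)"
  proof (rule integral_mono)
    show "integrable M (\<lambda>x. \<Sum>z\<in>Z. indicator {x \<in> space M. P z x} x :: real)"
      using assms(2) by (intro Bochner_Integration.integrable_sum) (auto simp: emeasure_eq_measure)
    fix x assume x: "x \<in> space M"
    have "(\<Sum>z\<in>Z. indicator {x \<in> space M. P z x} x) = real (card {z \<in> Z. P z x})"
      using assms(1) x by (simp add: indicator_def sum.If_cases Int_def)
    then show "(\<Sum>z\<in>Z. indicator {x \<in> space M. P z x} x) \<le> B" using assms(3)[OF x] by simp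
  qed simp
  finally show ?thesis by (simp add: prob_space)
qed

text \<open>Success on a given input depends on \<open>D\<close> only through
  \<open>run D ops\<close>, whose measurability is assumed.\<close>

lemma succeeds_measurable:
  assumes "randomized_data_structure G n s w R" "ops \<in> op_sequences G n s"
  shows "{D \<in> space R. succeeds G e n \<epsilon> \<delta> D ops} \<in> sets R"
proof -
  define P where "P r \<longleftrightarrow> real (length (filter (\<lambda>(x, y). x = y)
       (zip (fst r) (correct_answers G e (\<lambda>_. \<one>\<^bsub>G\<^esub>) ops)))) \<ge> (1 / 2 + \<delta>) * real (num_queries ops) \<and>
     real (snd r) \<le> \<epsilon> * real n * log 2 (real n)" for r :: "bool list \<times> nat"
  have "(\<lambda>D. run D ops) -` {r. P r} \<inter> space R \<in> sets R"
    using assms by (intro measurable_sets[of _ _ "count_space UNIV"]) (auto simp: randomized_data_structure_def)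
  moreover have "(\<lambda>D. run D ops) -` {r. P r} \<inter> space R = {D \<in> space R. succeeds G e n \<epsilon> \<delta> D ops}"
    by (auto simp: P_def succeeds_def num_correct_def answers_def running_time_def)
  ultimately show ?thesis by simp
qed

lemma success_prob_le:
  assumes G: "group G" "finite (carrier G)" and n: "n \<ge> 2" and s: "s > 0"
    and R: "randomized_data_structure G n s w R"
    and B: "\<And>D. data_structure_for G n s w D \<Longrightarrow>
      real (card {zs \<in> hard_inputs n G s. succeeds G e n \<epsilon> \<delta> D (hard_ops n G zs)})
      \<le> real (card (hard_inputs n G s)) * B"
  shows "success_prob G e n \<epsilon> \<delta> R (hard_pmf n G s) \<le> B"
proof -
  let ?I = "hard_inputs n G s"
  have I: "finite ?I" "?I \<noteq> {}" using G s by (auto simp: finite_hard_inputs hard_inputs_nonempty)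
  interpret prob_space R using R by (simp add: randomized_data_structure_def)
  have "success_prob G e n \<epsilon> \<delta> R (hard_pmf n G s)
     = (\<Sum>zs\<in>?I. prob {D \<in> space R. succeeds G e n \<epsilon> \<delta> D (hard_ops n G zs)}) / real (card ?I)"
    using n s I by (simp add: success_prob_def hard_pmf_def integral_pmf_of_set)
  also have "\<dots> \<le> (real (card ?I) * B) / real (card ?I)"
  proof (intro divide_right_mono sum_prob_le_of_card_le)
    show "{D \<in> space R. succeeds G e n \<epsilon> \<delta> D (hard_ops n G zs)} \<in> events" if "zs \<in> ?I" for zs
      using R hard_ops_valid[OF G(1) n that] by (rule succeeds_measurable)
    show "real (card {zs \<in> ?I. succeeds G e n \<epsilon> \<delta> D (hard_ops n G zs)}) \<le> real (card ?I) * B"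
      if "D \<in> space R" for D
      using R that by (intro B) (auto simp: randomized_data_structure_def)
  qed (use I in auto)
  also have "\<dots> = B" using I by simp
  finally show ?thesis .
qed

theorem theorem2:
  "\<exists>hard :: nat \<Rightarrow> 'g monoid \<Rightarrow> nat \<Rightarrow> ('g \<Rightarrow> bool list) \<Rightarrow> 'g operation list pmf.
     (\<forall>n G s e. group G \<and> finite (carrier G) \<and> binary_encoding G s e \<and> n \<ge> 1 \<longrightarrow>
        set_pmf (hard n G s e) \<subseteq> op_sequences G n s) \<and>
     (\<forall>w\<^sub>1 w\<^sub>2 g\<^sub>1 g\<^sub>2 \<gamma> :: real.
        w\<^sub>1 > 0 \<and> w\<^sub>2 > 0 \<and> g\<^sub>1 > 0 \<and> g\<^sub>2 > 0 \<and> \<gamma> > 0 \<longrightarrow>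
        (\<exists>(C :: real) (c :: real) (n\<^sub>0 :: nat). C > 0 \<and> c > 0 \<and>
          (\<forall>n \<ge> n\<^sub>0. \<forall>(G :: 'g monoid) (s :: nat) (e :: 'g \<Rightarrow> bool list) (w :: nat)
              (\<epsilon> :: real) (\<delta> :: real) (D :: 'g data_structure measure).
             group G \<and> finite (carrier G) \<and> binary_encoding G s e \<and>
             w\<^sub>1 * log 2 (real n) \<le> real w \<and> real w \<le> w\<^sub>2 * log 2 (real n) \<and>
             g\<^sub>1 * real w \<le> log 2 (real (card (carrier G))) \<and>
             log 2 (real (card (carrier G))) \<le> g\<^sub>2 * real w \<and>
             real s \<le> (1 + \<epsilon>) * log 2 (real (card (carrier G))) \<and>
             \<epsilon> \<ge> \<gamma> / log 2 (real n) \<and> \<delta> > 0 \<and> \<delta>\<^sup>2 \<ge> C * \<epsilon> \<and>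
             randomized_data_structure G n s w D \<longrightarrow>
             success_prob G e n \<epsilon> \<delta> D (hard n G s e) \<le> 2 powr (- c * \<delta>\<^sup>2 * real n))))"
\<comment> \<open>One distribution serves all encodings of length \<open>s\<close>.\<close>
proof (intro exI[of _ "\<lambda>n G s e. hard_pmf n G s"] conjI allI impI)
  fix n s :: nat and G :: "'g monoid" and e :: "'g \<Rightarrow> bool list"
  assume "group G \<and> finite (carrier G) \<and> binary_encoding G s e \<and> n \<ge> 1"
  then show "set_pmf (hard_pmf n G s) \<subseteq> op_sequences G n s" by (intro set_hard_pmf) auto
next
  fix w\<^sub>1 w\<^sub>2 g\<^sub>1 g\<^sub>2 \<gamma> :: real
  assume pos: "w\<^sub>1 > 0 \<and> w\<^sub>2 > 0 \<and> g\<^sub>1 > 0 \<and> g\<^sub>2 > 0 \<and> \<gamma> > 0"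
  \<comment> \<open>The first term controls the deviation of the digit count, the second the fees
    and the redundancy of the encoding.\<close>
  define C where "C = max (2 / \<gamma>) (32 * (1 / 2 + 8 * (1 + 1 / g\<^sub>1) + 4 / (g\<^sub>1 * w\<^sub>1)))"
  show "\<exists>(C :: real) (c :: real) (n\<^sub>0 :: nat). C > 0 \<and> c > 0 \<and>
          (\<forall>n \<ge> n\<^sub>0. \<forall>(G :: 'g monoid) (s :: nat) (e :: 'g \<Rightarrow> bool list) (w :: nat)
              (\<epsilon> :: real) (\<delta> :: real) (D :: 'g data_structure measure).
             group G \<and> finite (carrier G) \<and> binary_encoding G s e \<and>
             w\<^sub>1 * log 2 (real n) \<le> real w \<and> real w \<le> w\<^sub>2 * log 2 (real n) \<and>
             g\<^sub>1 * real w \<le> log 2 (real (card (carrier G))) \<and>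
             log 2 (real (card (carrier G))) \<le> g\<^sub>2 * real w \<and>
             real s \<le> (1 + \<epsilon>) * log 2 (real (card (carrier G))) \<and>
             \<epsilon> \<ge> \<gamma> / log 2 (real n) \<and> \<delta> > 0 \<and> \<delta>\<^sup>2 \<ge> C * \<epsilon> \<and>
             randomized_data_structure G n s w D \<longrightarrow>
             success_prob G e n \<epsilon> \<delta> D (hard_pmf n G s) \<le> 2 powr (- c * \<delta>\<^sup>2 * real n))"
  proof (intro exI conjI allI impI)
    show "C > 0" using pos by (simp add: C_def less_max_iff_disj)
    show "(1 / 128 :: real) > 0" by simp
  next
    fix n s w :: nat and G :: "'g monoid" and e :: "'g \<Rightarrow> bool list" and \<epsilon> \<delta> :: real
      and R :: "'g data_structure measure"
    assume n: "n \<ge> 16" and a: "group G \<and> finite (carrier G) \<and> binary_encoding G s e \<and>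
             w\<^sub>1 * log 2 (real n) \<le> real w \<and> real w \<le> w\<^sub>2 * log 2 (real n) \<and>
             g\<^sub>1 * real w \<le> log 2 (real (card (carrier G))) \<and>
             log 2 (real (card (carrier G))) \<le> g\<^sub>2 * real w \<and>
             real s \<le> (1 + \<epsilon>) * log 2 (real (card (carrier G))) \<and>
             \<epsilon> \<ge> \<gamma> / log 2 (real n) \<and> \<delta> > 0 \<and> \<delta>\<^sup>2 \<ge> C * \<epsilon> \<and>
             randomized_data_structure G n s w R"
    have "s > 0"
    proof (rule ccontr)
      assume "\<not> s > 0"
      then have "card (carrier G) \<le> 1" using a card_le_of_encoding[of G s e] by simp
      then have "log 2 (real (card (carrier G))) \<le> 0"
        by (cases "card (carrier G)") (auto simp: log_def)
      moreover have "log 2 (real n) > 0" using n by simp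
      then have "g\<^sub>1 * real w > 0" using a pos by (smt (verit) mult_pos_pos)
      ultimately show False using a by linarith
    qed
    have "success_prob G e n \<epsilon> \<delta> R (hard_pmf n G s) \<le> exp (- \<delta>\<^sup>2 * real n / 128)"
    proof (rule success_prob_le)
      fix D assume "data_structure_for G n s w D"
      then show "real (card {zs \<in> hard_inputs n G s. succeeds G e n \<epsilon> \<delta> D (hard_ops n G zs)})
          \<le> real (card (hard_inputs n G s)) * exp (- \<delta>\<^sup>2 * real n / 128)"
        using a n pos by (intro card_successes_le[of w\<^sub>1 g\<^sub>1 \<gamma> n G s e w \<epsilon> \<delta> C]) (auto simp: C_def)
    qed (use a n \<open>s > 0\<close> in auto)
    also have "\<dots> \<le> 2 powr (- (1 / 128) * \<delta>\<^sup>2 * real n)"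
    proof -
      have "\<delta>\<^sup>2 * real n / 128 * ln 2 \<le> \<delta>\<^sup>2 * real n / 128"
        using ln_2_less_1 by (intro mult_left_le) auto
      then show ?thesis by (simp add: powr_def)
    qed
    finally show "success_prob G e n \<epsilon> \<delta> R (hard_pmf n G s) \<le> 2 powr (- (1 / 128) * \<delta>\<^sup>2 * real n)" .
  qed
qed

end
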